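(* Let $Z$ be a nonempty countable set and let $\phi$ be a random lattice field on $Z$, defined on a probability space $(\Omega,\mathcal{M},\mu)$ and closed under complex conjugation. Let $N\in\mathbb{N}_+$ and suppose $\phi$ is $\ell_p$-clustering up to order $2N$. Let $X\in L^2(\mu)$ be a complex random variable. Then, for every $n\in\mathbb{N}_+$ with $n\le N$: <ol> <li>If $p=1$, $$\Bigl[\sum_{x\in Z^n}\bigl|\kappa[X,\phi(x_1),\ldots,\phi(x_n)]\bigr|^2\Bigr]^{1/2}\le \sqrt{\operatorname{cov}(X^*,X)}\; M_{2n}(\phi;1)^n\, e^{n}\sqrt{(2n)!}.$$</li> <li>If $p=2$, $$\sup_{x'\in Z^n}\Bigl[\sum_{x\in Z^n}|\Phi_n(x',x)|\,\bigl|\kappa[X,\phi(x_1),\ldots,\phi(x_n)]\bigr|^2\Bigr]^{1/2}\le \sqrt{\operatorname{cov}(X^*,X)}\; M_{2n}(\phi;2)^{2n}\, e^{2n}(2n)!,$$ where $\Phi_n(x',x):=\mathbb{E}\bigl[{:}\phi(x'_1)^*\cdots\phi(x'_n)^*{:}\;{:}\phi(x_1)\cdots\phi(x_n){:}\bigr]$.</li> </ol> In particular, all the sums above are finite.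
   Context: A random lattice field on a countable set $Z$ is a family $(\phi(x))_{x\in Z}$ of complex random variables on a common probability space $(\Omega,\mathcal{M},\mu)$; $\mathbb{E}$ denotes expectation. The field is closed under complex conjugation if for every $x\in Z$ there is $x_*\in Z$ with $\phi(x)^*=\phi(x_* )$. $\kappa[Y_1,\ldots,Y_n]$ denotes the joint cumulant of the random variables $Y_1,\dots,Y_n$ (so $\kappa[Y]=\mathbb{E}[Y]$), and $\operatorname{cov}(X^*,X)=\kappa[X^*,X]=\mathbb{E}|X|^2-|\mathbb{E}X|^2$. For $1\le p<\infty$ and $n\ge 2$, the $\ell_p$-clustering norms are $\|\phi\|^{(n)}_p:=\sup_{x_0\in Z}\bigl[\sum_{x\in Z^{n-1}}|\kappa[\phi(x_0),\phi(x_1),\ldots,\phi(x_{n-1})]|^p\bigr]^{1/p}$, and $\|\phi\|^{(1)}_p:=\sup_{x_0\in Z}|\mathbb{E}[\phi(x_0)]|$; for $p=\infty$, $\|\phi\|^{(n)}_\infty:=\sup_{x\in Z^n}|\kappa[\phi(x_1),\ldots,\phi(x_n)]|$. The field is $\ell_p$-clustering up to order $m$ if all these cumulants exist and $\|\phi\|^{(n)}_p<\infty$ for all $1\le n\le m$. Set $M_N(\phi;p):=\max_{1\le n\le N}\bigl(\frac{1}{n!}\|\phi\|^{(n)}_p\bigr)^{1/n}$. Wick polynomials (with respect to $\mu$): for a finite sequence $I=(i_1,\dots,i_k)$ of random variables $y_{i_j}$ with $y^I:=y_{i_1}\cdots y_{i_k}$ (and $y^\emptyset=1$), having all needed moments finite,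 ${:}y^I{:}$ is defined recursively by ${:}y^\emptyset{:}=1$ and ${:}y^I{:}=y^I-\sum_{E\subsetneq I}\mathbb{E}[y^{I\setminus E}]\,{:}y^E{:}$, the sum running over proper subsequences $E$ of $I$. *)

theory Defs
  imports "HOL-Probability.Probability"
begin

definition cumulant :: "'w measure \<Rightarrow> ('w \<Rightarrow> complex) list \<Rightarrow> complex" where
  "cumulant M Ys =
     (\<Sum>P\<in>{P. partition_on {..<length Ys} P}.
        (-1) ^ (card P - 1) * of_nat (fact (card P - 1)) *
        (\<Prod>B\<in>P. integral\<^sup>L M (\<lambda>\<omega>. \<Prod>i\<in>B. (Ys ! i) \<omega>)))"

function wick_idx :: "'w measure \<Rightarrow> (nat \<Rightarrow> 'w \<Rightarrow> complex) \<Rightarrow> nat set \<Rightarrow> 'w \<Rightarrow> complex" where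
  "wick_idx M Y S \<omega> =
     (if finite S then
        (\<Prod>i\<in>S. Y i \<omega>)
        - (\<Sum>E\<in>{E. E \<subset> S}. integral\<^sup>L M (\<lambda>\<omega>'. \<Prod>i\<in>S - E. Y i \<omega>') * wick_idx M Y E \<omega>)
      else 0)"
  by auto
termination
  by (relation "Wellfounded.measure (\<lambda>(M, Y, S, \<omega>). card S)") (auto simp: psubset_card_mono)

definition wick :: "'w measure \<Rightarrow> ('w \<Rightarrow> complex) list \<Rightarrow> 'w \<Rightarrow> complex" where
  "wick M Ys = wick_idx M (\<lambda>i. Ys ! i) {..<length Ys}"

definition random_field :: "'w measure \<Rightarrow> ('z \<Rightarrow> 'w \<Rightarrow> complex) \<Rightarrow> bool" where
  "random_field M \<phi> \<longleftrightarrow> (\<forall>x. \<phi> x \<in> borel_measurable M)"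

definition closed_conj :: "'w measure \<Rightarrow> ('z \<Rightarrow> 'w \<Rightarrow> complex) \<Rightarrow> bool" where
  "closed_conj M \<phi> \<longleftrightarrow> (\<forall>x. \<exists>y. AE \<omega> in M. cnj (\<phi> x \<omega>) = \<phi> y \<omega>)"

definition moments_exist :: "'w measure \<Rightarrow> ('z \<Rightarrow> 'w \<Rightarrow> complex) \<Rightarrow> nat \<Rightarrow> bool" where
  "moments_exist M \<phi> m \<longleftrightarrow>
     (\<forall>xs. length xs \<le> m \<longrightarrow> integrable M (\<lambda>\<omega>. \<Prod>i<length xs. \<phi> (xs ! i) \<omega>))"

definition clust_sum :: "'w measure \<Rightarrow> ('z \<Rightarrow> 'w \<Rightarrow> complex) \<Rightarrow> real \<Rightarrow> nat \<Rightarrow> 'z \<Rightarrow> ennreal" where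
  "clust_sum M \<phi> p n x0 =
     (\<integral>\<^sup>+ xs. ennreal (cmod (cumulant M (map \<phi> (x0 # xs))) powr p)
        \<partial>count_space {xs. length xs = n - 1})"

text \<open>The l_p clustering norm (1 <= p < infinity); meaningful when finite.\<close>
definition clust_norm :: "'w measure \<Rightarrow> ('z \<Rightarrow> 'w \<Rightarrow> complex) \<Rightarrow> real \<Rightarrow> nat \<Rightarrow> real" where
  "clust_norm M \<phi> p n =
     (if n = 1 then (SUP x0. cmod (integral\<^sup>L M (\<phi> x0)))
      else (enn2real (SUP x0. clust_sum M \<phi> p n x0)) powr (1 / p))"

definition clustering :: "'w measure \<Rightarrow> ('z \<Rightarrow> 'w \<Rightarrow> complex) \<Rightarrow> real \<Rightarrow> nat \<Rightarrow> bool" where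
  "clustering M \<phi> p m \<longleftrightarrow>
     moments_exist M \<phi> m \<and>
     (1 \<le> m \<longrightarrow> bdd_above (range (\<lambda>x0. cmod (integral\<^sup>L M (\<phi> x0))))) \<and>
     (\<forall>n. 2 \<le> n \<and> n \<le> m \<longrightarrow> (SUP x0. clust_sum M \<phi> p n x0) < \<infinity>)"

definition M_const :: "'w measure \<Rightarrow> ('z \<Rightarrow> 'w \<Rightarrow> complex) \<Rightarrow> real \<Rightarrow> nat \<Rightarrow> real" where
  "M_const M \<phi> p N =
     Max ((\<lambda>n. (clust_norm M \<phi> p n / fact n) powr (1 / real n)) ` {1..N})"

definition Phi :: "'w measure \<Rightarrow> ('z \<Rightarrow> 'w \<Rightarrow> complex) \<Rightarrow> 'z list \<Rightarrow> 'z list \<Rightarrow> complex" where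
  "Phi M \<phi> x' x =
     integral\<^sup>L M (\<lambda>\<omega>. wick M (map (\<lambda>y \<omega>. cnj (\<phi> y \<omega>)) x') \<omega> * wick M (map \<phi> x) \<omega>)"

definition covX :: "'w measure \<Rightarrow> ('w \<Rightarrow> complex) \<Rightarrow> real" where
  "covX M X = integral\<^sup>L M (\<lambda>\<omega>. (cmod (X \<omega>))\<^sup>2) - (cmod (integral\<^sup>L M X))\<^sup>2"

end

theory Submission
  imports Defs
begin

text \<open>
  Proof idea. Since the Wick polynomial \<open>V\<^sub>x\<close> of \<open>\<phi>(x\<^sub>1)\<cdots>\<phi>(x\<^sub>n)\<close> has mean zero and
  \<open>\<kappa>[X, \<phi>(x\<^sub>1), \<dots>, \<phi>(x\<^sub>n)] = E[X V\<^sub>x]\<close>, the weighted sum \<open>S = \<Sum> w\<^sub>x |\<kappa>\<^sub>x|\<^sup>2\<close> equals \<open>E[(X - E X) h]\<close> with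
  \<open>h = \<Sum> w\<^sub>x \<kappa>\<^sub>x\<^sup>* V\<^sub>x\<close>. If \<open>\<Sum>\<^sub>y w\<^sub>y |\<Phi>(x, y)| \<le> C\<close> for all \<open>x\<close>, the Schur test gives \<open>E|h|\<^sup>2 \<le> C S\<close>, and
  Cauchy-Schwarz gives \<open>S \<le> C cov(X\<^sup>*, X)\<close>. Item 1 is \<open>w = 1\<close>; item 2 is
  \<open>w = |\<Phi>(x', \<sqdot>)|\<close>, where \<open>C\<close> comes from the \<open>\<ell>\<^sub>2\<close> norms of the rows of \<open>\<Phi>\<close>.

  The \<open>\<ell>\<^sub>p\<close> norms of these rows are bounded by peeling off the block \<open>B\<close> of a fixed factor on the \<open>x'\<close>
  side: only blocks that also contain factors on the \<open>x\<close> side contribute, so summing over the latter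
  costs one clustering norm of order \<open>|B|\<close>.
\<close>

section \<open>Moments and cumulants\<close>

text \<open>Every identity between moments, cumulants and Wick polynomials comes from one device:
  the subset convolution \<open>(\<Sum>E\<in>Pow S. m (S - E) * f E)\<close> with the moments is
  injective because \<open>m {} = 1\<close>, so it is enough that two set functions have the same
  convolution. No partition formula for Wick polynomials or for their pair expectations is written
  down. For this the variables are indexed by finite sets, which also keeps repeated points apart,
  and \<open>m\<close> is an arbitrary set function as long as the argument is purely combinatorial.

  Closure under conjugation turns \<open>Phi\<close> into a pair expectation of the field itself, of
  total order \<open>2 * n\<close>; this explains the order \<open>2 * N\<close> and the constant
  \<open>M_const\<close> at \<open>2 * n\<close>. The peeling gives
  \<open>fact k * (2 * \<mu>) ^ k\<close> for \<open>k\<close> factors, where 2 is the price of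
  summing over all sizes of the peeled block; it is absorbed in \<open>exp 1\<close>.

  All estimates are made on finite sets of lists with bounds that do not depend on the set;
  summability is read off at the end.\<close>

definition moebius_cumulant :: "('i set \<Rightarrow> complex) \<Rightarrow> 'i set \<Rightarrow> complex" where
  "moebius_cumulant m S =
     (\<Sum>P\<in>{P. partition_on S P}. (-1) ^ (card P - 1) * of_nat (fact (card P - 1)) * (\<Prod>B\<in>P. m B))"

lemma moebius_cumulant_cong:
  assumes "\<And>B. B \<subseteq> S \<Longrightarrow> m B = m' B"
  shows "moebius_cumulant m S = moebius_cumulant m' S"
proof -
  have "(\<Prod>B\<in>P. m B) = (\<Prod>B\<in>P. m' B)" if "partition_on S P" for P
    using that assms by (intro prod.cong) (auto simp: partition_on_def)
  then show ?thesis
    unfolding moebius_cumulant_def by (intro sum.cong) auto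
qed

lemma partition_on_remove_block:
  assumes "partition_on S Q" "D \<in> Q"
  shows "partition_on (S - D) (Q - {D})"
proof -
  have "\<Union>(Q - {D}) = S - D"
    using assms by (auto simp: partition_on_def disjoint_def)
  then show ?thesis
    using assms by (auto simp: partition_on_def disjoint_def)
qed

lemma partition_on_insert_block:
  assumes "partition_on B P" "B \<subset> S"
  shows "partition_on S (insert (S - B) P)"
  using assms by (auto simp: partition_on_def disjoint_def)

text \<open>With \<open>c k = (-1) ^ (k - 1) * fact (k - 1)\<close> this reads
  \<open>(k - 1) * c (k - 1) = - c k\<close>, the cancellation behind the moment recursion. It fails
  at \<open>k = 1\<close>, which is why the one-block partition survives there.\<close>

lemma moebius_weight:
  assumes "k \<ge> 2"
  shows "of_nat (k - 1) * ((-1) ^ (k - 1 - 1) * of_nat (fact (k - 1 - 1)))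
       = - ((-1) ^ (k - 1) * of_nat (fact (k - 1)) :: complex)"
proof -
  obtain j where "k = Suc (Suc j)"
    using assms by (metis Suc_le_D numeral_2_eq_2 Suc_le_mono)
  then show ?thesis by (simp add: algebra_simps)
qed

text \<open>For proper \<open>B\<close>, a partition of \<open>B\<close> together with the single
  block \<open>S - B\<close> is a partition \<open>Q\<close> of \<open>S\<close> with a marked block
  that avoids \<open>a\<close>. Exactly \<open>card Q - 1\<close> blocks of \<open>Q\<close> can be
  marked, so by \<open>moebius_weight\<close> these terms cancel those of
  \<open>moebius_cumulant m S\<close>, except for \<open>Q = {S}\<close>, which leaves
  \<open>m S\<close>.\<close>

lemma moment_cumulant_recursion:
  assumes S: "finite S" and a: "a \<in> S" and m1: "m {} = 1"
  shows "m S = (\<Sum>B\<in>{B. a \<in> B \<and> B \<subseteq> S}. moebius_cumulant m B * m (S - B))"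
proof -
  define c :: "nat \<Rightarrow> complex" where "c k = (-1) ^ (k - 1) * of_nat (fact (k - 1))" for k
  define g where "g P = (\<Prod>B\<in>P. m B)" for P
  have kap: "moebius_cumulant m B = (\<Sum>P\<in>{P. partition_on B P}. c (card P) * g P)" for B
    by (simp add: moebius_cumulant_def c_def g_def)
  have finP: "finite {P. partition_on B P}" if "B \<subseteq> S" for B
    using finitely_many_partition_on[of B] S that finite_subset by auto
  have finQ: "finite Q" if "partition_on S Q" for Q
    using that S finite_elements by blast
  have "(\<Sum>B\<in>{B. a \<in> B \<and> B \<subset> S}. moebius_cumulant m B * m (S - B))
      = (\<Sum>B\<in>{B. a \<in> B \<and> B \<subset> S}. \<Sum>P\<in>{P. partition_on B P}. c (card P) * g P * m (S - B))"
    by (simp add: kap sum_distrib_right)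
  also have "\<dots> = (\<Sum>(B, P)\<in>(SIGMA B:{B. a \<in> B \<and> B \<subset> S}. {P. partition_on B P}).
      c (card P) * g P * m (S - B))"
    using S finP by (intro sum.Sigma) (auto intro: finite_subset[of _ "Pow S"])
  also have "\<dots> = (\<Sum>(Q, D)\<in>(SIGMA Q:{Q. partition_on S Q}. {D \<in> Q. a \<notin> D}). c (card Q - 1) * g Q)"
  proof (rule sum.reindex_bij_witness[of _ "\<lambda>(Q, D). (S - D, Q - {D})" "\<lambda>(B, P). (insert (S - B) P, S - B)"],
      goal_cases)
    case (1 x) 
    obtain B P where x: "x = (B, P)" by force
    then have B: "a \<in> B" "B \<subset> S" and P: "partition_on B P" using 1 by auto
    then have "S - B \<notin> P" by (auto simp: partition_on_def)
    then show ?case using x B by auto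
  next
    case (2 x) 
    obtain B P where x: "x = (B, P)" by force
    then have B: "a \<in> B" "B \<subset> S" and P: "partition_on B P" using 2 by auto
    then show ?case using x partition_on_insert_block[OF P B(2)] by auto
  next
    case (3 x)
    obtain Q D where x: "x = (Q, D)" by force
    then have Q: "partition_on S Q" "D \<in> Q" using 3 by auto
    then have "S - (S - D) = D" by (auto simp: partition_on_def)
    then show ?case using x Q by auto
  next
    case (4 x)
    obtain Q D where x: "x = (Q, D)" by force
    then have Q: "partition_on S Q" "D \<in> Q" "a \<notin> D" using 4 by auto
    then have "D \<noteq> {}" "D \<subseteq> S" by (auto simp: partition_on_def)
    then show ?case using x Q a partition_on_remove_block[of S Q D] by auto
  next
    case (5 x)
    obtain B P where x: "x = (B, P)" by force
    then have B: "a \<in> B" "B \<subset> S" and P: "partition_on B P" using 5 by auto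
    then have "S - B \<notin> P" by (auto simp: partition_on_def)
    moreover have "finite P" using P B S by (meson finite_elements finite_subset psubsetE)
    ultimately show ?case using x by (simp add: g_def mult_ac)
  qed
  also have "\<dots> = (\<Sum>Q\<in>{Q. partition_on S Q}. \<Sum>D\<in>{D \<in> Q. a \<notin> D}. c (card Q - 1) * g Q)"
    using finP[OF subset_refl] finQ by (intro sum.Sigma[symmetric]) auto
  also have "\<dots> = (\<Sum>Q\<in>{Q. partition_on S Q}. of_nat (card Q - 1) * c (card Q - 1) * g Q)"
  proof (intro sum.cong refl)
    fix Q assume "Q \<in> {Q. partition_on S Q}"
    then have Q: "partition_on S Q" by simp
    obtain A where A: "A \<in> Q" "a \<in> A" using Q a by (auto simp: partition_on_def)
    have "{D \<in> Q. a \<notin> D} = Q - {A}"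
      using Q A by (auto simp: partition_on_def disjoint_def)
    then have "card {D \<in> Q. a \<notin> D} = card Q - 1" using A finQ[OF Q] by simp
    then show "(\<Sum>D\<in>{D \<in> Q. a \<notin> D}. c (card Q - 1) * g Q) = of_nat (card Q - 1) * c (card Q - 1) * g Q"
      by simp
  qed
  finally have proper: "(\<Sum>B\<in>{B. a \<in> B \<and> B \<subset> S}. moebius_cumulant m B * m (S - B))
    = (\<Sum>Q\<in>{Q. partition_on S Q}. of_nat (card Q - 1) * c (card Q - 1) * g Q)" .
  have "{B. a \<in> B \<and> B \<subseteq> S} = insert S {B. a \<in> B \<and> B \<subset> S}" using a by auto
  moreover have "finite {B. a \<in> B \<and> B \<subset> S}" using S by (auto intro: finite_subset[of _ "Pow S"])
  ultimately have "(\<Sum>B\<in>{B. a \<in> B \<and> B \<subseteq> S}. moebius_cumulant m B * m (S - B))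
     = moebius_cumulant m S + (\<Sum>B\<in>{B. a \<in> B \<and> B \<subset> S}. moebius_cumulant m B * m (S - B))"
    using m1 by simp
  also have "\<dots> = (\<Sum>Q\<in>{Q. partition_on S Q}. (c (card Q) + of_nat (card Q - 1) * c (card Q - 1)) * g Q)"
    unfolding proper kap[of S] by (simp add: sum.distrib algebra_simps)
  also have "\<dots> = (\<Sum>Q\<in>{Q. partition_on S Q}. if Q = {S} then m S else 0)"
  proof (intro sum.cong refl)
    fix Q assume "Q \<in> {Q. partition_on S Q}"
    then have Q: "partition_on S Q" by simp
    have "Q \<noteq> {}" using Q a by (auto simp: partition_on_def)
    then have c0: "card Q \<noteq> 0" using finQ[OF Q] by simp
    show "(c (card Q) + of_nat (card Q - 1) * c (card Q - 1)) * g Q = (if Q = {S} then m S else 0)"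
    proof (cases "card Q = 1")
      case True
      then obtain A where "Q = {A}" by (auto simp: card_1_singleton_iff)
      moreover then have "A = S" using Q by (auto simp: partition_on_def)
      ultimately show ?thesis by (simp add: c_def g_def)
    next
      case False
      then have "card Q \<ge> 2" using c0 by linarith
      moreover have "Q \<noteq> {S}" using False by auto
      ultimately show ?thesis using moebius_weight[of "card Q"] by (simp add: c_def)
    qed
  qed
  also have "\<dots> = m S"
    using finP[OF subset_refl] a by (auto simp: sum.delta partition_on_def disjoint_def)
  finally show ?thesis by simp
qed

text \<open>The recursion solved for its top term determines the cumulant by induction on proper
  subsets. Thus \<open>moebius_cumulant_reindex\<close> need not transport partitions along
  \<open>f\<close>.\<close>

lemma moebius_cumulant_eq:
  assumes S: "finite S" and a: "a \<in> S" and m1: "m {} = 1"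
  shows "moebius_cumulant m S = m S - (\<Sum>B\<in>{B. a \<in> B \<and> B \<subset> S}. moebius_cumulant m B * m (S - B))"
proof -
  have "{B. a \<in> B \<and> B \<subseteq> S} = insert S {B. a \<in> B \<and> B \<subset> S}" using a by auto
  moreover have "finite {B. a \<in> B \<and> B \<subset> S}" using S by (auto intro: finite_subset[of _ "Pow S"])
  ultimately show ?thesis
    using moment_cumulant_recursion[of S a m] assms by simp
qed

lemma moebius_cumulant_reindex:
  assumes "finite S" "S \<noteq> {}" "inj_on f S" "m {} = 1"
  shows "moebius_cumulant m (f ` S) = moebius_cumulant (\<lambda>B. m (f ` B)) S"
  using assms
proof (induction S rule: finite_psubset_induct)
  case (psubset S)
  obtain a where a: "a \<in> S" using psubset by blast
  let ?R = "\<lambda>S. {B. a \<in> B \<and> B \<subset> S}"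
  have img: "{B. f a \<in> B \<and> B \<subset> f ` S} = (`) f ` ?R S"
  proof (intro equalityI subsetI)
    fix C assume C: "C \<in> {B. f a \<in> B \<and> B \<subset> f ` S}"
    define B where "B = {i \<in> S. f i \<in> C}"
    have "C = f ` B" "a \<in> B" "B \<subset> S" using C a by (auto simp: B_def)
    then show "C \<in> (`) f ` ?R S" by auto
  next
    fix C assume "C \<in> (`) f ` ?R S"
    then obtain B where "C = f ` B" "a \<in> B" "B \<subset> S" by auto
    then show "C \<in> {B. f a \<in> B \<and> B \<subset> f ` S}"
      using inj_on_image_eq_iff[OF psubset.prems(2), of B S] by auto
  qed
  have inj: "inj_on ((`) f) (?R S)"
    using inj_on_image_eq_iff[OF psubset.prems(2)] by (auto intro!: inj_onI)
  have "moebius_cumulant m (f ` S)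
     = m (f ` S) - (\<Sum>B\<in>?R S. moebius_cumulant m (f ` B) * m (f ` S - f ` B))"
    using moebius_cumulant_eq[of "f ` S" "f a" m] a psubset.hyps psubset.prems
    by (simp add: img sum.reindex[OF inj])
  also have "(\<Sum>B\<in>?R S. moebius_cumulant m (f ` B) * m (f ` S - f ` B))
    = (\<Sum>B\<in>?R S. moebius_cumulant (\<lambda>B. m (f ` B)) B * m (f ` (S - B)))"
  proof (intro sum.cong refl)
    fix B assume B: "B \<in> ?R S"
    have "inj_on f B" using B psubset.prems(2) inj_on_subset by blast
    then have "moebius_cumulant m (f ` B) = moebius_cumulant (\<lambda>B. m (f ` B)) B"
      using psubset.IH[of B] B psubset.prems by auto
    moreover have "f ` S - f ` B = f ` (S - B)"
      using inj_on_image_set_diff[OF psubset.prems(2), of S B] B by auto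
    ultimately show "moebius_cumulant m (f ` B) * m (f ` S - f ` B)
      = moebius_cumulant (\<lambda>B. m (f ` B)) B * m (f ` (S - B))" by simp
  qed
  also have "m (f ` S) - \<dots> = moebius_cumulant (\<lambda>B. m (f ` B)) S"
    using moebius_cumulant_eq[of S a "\<lambda>B. m (f ` B)"] a psubset.hyps psubset.prems by simp
  finally show ?case .
qed

text \<open>The convolution is unitriangular: the term \<open>E = T\<close> has coefficient
  \<open>c {} = 1\<close> and all others involve proper subsets of \<open>T\<close>, where the
  induction hypothesis applies.\<close>

lemma Pow_convolution_inject:
  fixes c f g :: "'i set \<Rightarrow> complex"
  assumes "finite T" "c {} = 1"
    and "\<And>S. S \<subseteq> T \<Longrightarrow> (\<Sum>E\<in>Pow S. c (S - E) * f E) = (\<Sum>E\<in>Pow S. c (S - E) * g E)"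
  shows "f T = g T"
  using assms
proof (induction T rule: finite_psubset_induct)
  case (psubset T)
  have fin: "finite (Pow T - {T})" using psubset by simp
  have *: "(\<Sum>E\<in>Pow T. c (T - E) * h E) = h T + (\<Sum>E\<in>Pow T - {T}. c (T - E) * h E)" for h
    using psubset by (subst sum.remove[of _ T]) auto
  have "f E = g E" if "E \<in> Pow T - {T}" for E
  proof -
    have E: "E \<subset> T" using that by auto
    show ?thesis
      using psubset.prems E by (intro psubset.IH[OF E]) auto
  qed
  then show ?case
    using psubset.prems(2)[OF order_refl] by (simp add: *)
qed

text \<open>Both sides have the same double convolution with \<open>m\<close>: blocks of \<open>a\<close> inside \<open>I\<close> account for the
  summands with \<open>a \<notin> E\<close>, blocks that meet \<open>J\<close> for those with \<open>a \<in> E\<close>.\<close>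

lemma pair_moment_recursion:
  fixes m :: "'i set \<Rightarrow> complex" and G :: "'i set \<Rightarrow> 'i set \<Rightarrow> complex"
  assumes fin: "finite I0" "finite J0" and disj: "I0 \<inter> J0 = {}" and a: "a \<in> I0" and m1: "m {} = 1"
    and mG: "\<And>I J. I \<subseteq> I0 \<Longrightarrow> J \<subseteq> J0 \<Longrightarrow>
       m (I \<union> J) = (\<Sum>E\<in>Pow I. \<Sum>F\<in>Pow J. m (I - E) * m (J - F) * G E F)"
  shows "G I0 J0 = (\<Sum>B\<in>{B. a \<in> B \<and> B \<subseteq> I0 \<union> J0 \<and> B \<inter> J0 \<noteq> {}}.
     moebius_cumulant m B * G (I0 - B) (J0 - B))"
proof -
  define \<B> where "\<B> I J = {B. a \<in> B \<and> B \<subseteq> I \<union> J \<and> B \<inter> J \<noteq> {}}" for I J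
  define H where "H I J = (\<Sum>B\<in>\<B> I J. moebius_cumulant m B * G (I - B) (J - B))" for I J
  \<comment> \<open>The recursion is expected only for \<open>a \<in> E\<close>. Setting
    \<open>d\<close> to 0 elsewhere lets the defect be tested by convolution over all of
    \<open>Pow I\<close>; the claim becomes \<open>d I0 J0 = 0\<close>.\<close>
  define d where "d E F = (if a \<in> E then G E F - H E F else 0)" for E F
  have zero: "(\<Sum>E\<in>Pow I. \<Sum>F\<in>Pow J. m (I - E) * m (J - F) * d E F) = 0"
    if I: "I \<subseteq> I0" and J: "J \<subseteq> J0" for I J
  proof (cases "a \<in> I")
    case False
    then show ?thesis by (intro sum.neutral ballI) (auto simp: d_def)
  next
    case aI: True
    have aJ: "a \<notin> J" using a disj J by auto
    have finI: "finite I" and finJ: "finite J" using I J fin finite_subset by auto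
    have finB: "finite (\<B> E F)" if "E \<subseteq> I" "F \<subseteq> J" for E F
      using that finI finJ by (auto simp: \<B>_def intro: finite_subset[of _ "Pow (I \<union> J)"])
    let ?\<A> = "{B. a \<in> B \<and> B \<subseteq> I}"
    have finA: "finite ?\<A>" using finI by (auto intro: finite_subset[of _ "Pow I"])
    have split: "{B. a \<in> B \<and> B \<subseteq> I \<union> J} = ?\<A> \<union> \<B> I J" "?\<A> \<inter> \<B> I J = {}"
      using I J disj by (auto simp: \<B>_def)
    define t where "t B = moebius_cumulant m B *
      (\<Sum>E\<in>Pow (I - B). \<Sum>F\<in>Pow (J - B). m (I - B - E) * m (J - B - F) * G E F)" for B
    \<comment> \<open>The double convolution of \<open>G\<close> is \<open>m (I \<union> J)\<close>
      by \<open>mG\<close>; the recursion at \<open>a\<close> yields a second expansion of the same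
      moment, to be compared with it.\<close>
    have "m (I \<union> J) = (\<Sum>B\<in>{B. a \<in> B \<and> B \<subseteq> I \<union> J}. moebius_cumulant m B * m (I \<union> J - B))"
      using aI finI finJ m1 by (intro moment_cumulant_recursion) auto
    also have "\<dots> = (\<Sum>B\<in>{B. a \<in> B \<and> B \<subseteq> I \<union> J}. t B)"
    proof (intro sum.cong refl)
      fix B
      have "I \<union> J - B = (I - B) \<union> (J - B)" by auto
      then show "moebius_cumulant m B * m (I \<union> J - B) = t B"
        unfolding t_def using mG[of "I - B" "J - B"] I J by (simp add: subset_iff)
    qed
    also have "\<dots> = sum t ?\<A> + sum t (\<B> I J)"
      unfolding split(1) using finA finB[OF order_refl order_refl] split(2) by (intro sum.union_disjoint)
    also have "sum t ?\<A> = (\<Sum>E\<in>Pow I. if a \<in> E then 0 else \<Sum>F\<in>Pow J. m (I - E) * m (J - F) * G E F)"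
    proof -
      have "sum t ?\<A> = (\<Sum>B\<in>?\<A>. \<Sum>E\<in>{E \<in> Pow I. E \<inter> B = {}}.
         moebius_cumulant m B * m (I - E - B) * (\<Sum>F\<in>Pow J. m (J - F) * G E F))"
      proof (intro sum.cong refl)
        fix B assume B: "B \<in> ?\<A>"
        have JB: "J - B = J" using B I J disj by auto
        have PB: "Pow (I - B) = {E \<in> Pow I. E \<inter> B = {}}" by auto
        have c: "I - B - E = I - E - B" for E by auto
        show "t B = (\<Sum>E\<in>{E \<in> Pow I. E \<inter> B = {}}.
          moebius_cumulant m B * m (I - E - B) * (\<Sum>F\<in>Pow J. m (J - F) * G E F))"
          unfolding t_def JB PB c by (simp add: sum_distrib_left mult.assoc)
      qed
      \<comment> \<open>For fixed \<open>E\<close> the blocks are the subsets of \<open>I\<close>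
        that contain \<open>a\<close> and avoid \<open>E\<close>: there are none if
        \<open>a \<in> E\<close>, and otherwise the recursion on \<open>I - E\<close> collects them
        into \<open>m (I - E)\<close>.\<close>
      also have "\<dots> = (\<Sum>E\<in>Pow I. \<Sum>B\<in>{B \<in> ?\<A>. E \<inter> B = {}}.
         moebius_cumulant m B * m (I - E - B) * (\<Sum>F\<in>Pow J. m (J - F) * G E F))"
        using finA finI by (intro sum.swap_restrict) auto
      also have "\<dots> = (\<Sum>E\<in>Pow I. if a \<in> E then 0 else \<Sum>F\<in>Pow J. m (I - E) * m (J - F) * G E F)"
      proof (intro sum.cong refl)
        fix E assume E: "E \<in> Pow I"
        show "(\<Sum>B\<in>{B \<in> ?\<A>. E \<inter> B = {}}.
           moebius_cumulant m B * m (I - E - B) * (\<Sum>F\<in>Pow J. m (J - F) * G E F))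
         = (if a \<in> E then 0 else \<Sum>F\<in>Pow J. m (I - E) * m (J - F) * G E F)"
        proof (cases "a \<in> E")
          case True
          then have none: "{B \<in> ?\<A>. E \<inter> B = {}} = {}" by auto
          show ?thesis unfolding none using True by simp
        next
          case False
          have avoid: "{B \<in> ?\<A>. E \<inter> B = {}} = {B. a \<in> B \<and> B \<subseteq> I - E}" by auto
          have "m (I - E) = (\<Sum>B\<in>{B. a \<in> B \<and> B \<subseteq> I - E}. moebius_cumulant m B * m (I - E - B))"
            using aI False finI m1 by (intro moment_cumulant_recursion) auto
          then have "m (I - E) * C = (\<Sum>B\<in>{B. a \<in> B \<and> B \<subseteq> I - E}.
            moebius_cumulant m B * m (I - E - B) * C)" for C
            by (simp add: sum_distrib_right)
          note this[of "\<Sum>F\<in>Pow J. m (J - F) * G E F", symmetric]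
          then show ?thesis
            unfolding avoid using False by (simp add: sum_distrib_left mult.assoc)
        qed
      qed
      finally show ?thesis .
    qed
    also have "sum t (\<B> I J) = (\<Sum>E\<in>Pow I. \<Sum>F\<in>Pow J. m (I - E) * m (J - F) * H E F)"
    proof -
      have "sum t (\<B> I J) = (\<Sum>(B, E, F)\<in>(SIGMA B:\<B> I J. Pow (I - B) \<times> Pow (J - B)).
        moebius_cumulant m B * (m (I - B - E) * m (J - B - F) * G E F))"
        unfolding t_def using finB[OF order_refl order_refl] finI finJ
        by (subst sum.Sigma[symmetric]) (auto simp: sum.cartesian_product sum_distrib_left case_prod_unfold)
      \<comment> \<open>The block is put back into both arguments: \<open>(E, F)\<close> becomes
        \<open>(E \<union> (B \<inter> I), F \<union> (B \<inter> J))\<close>. The moment factors do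
        not change, and for fixed new arguments the sum over \<open>B\<close> is the one that
        defines \<open>H\<close>.\<close>
      also have "\<dots> = (\<Sum>((E, F), B)\<in>(SIGMA (E, F):Pow I \<times> Pow J. \<B> E F).
        m (I - E) * m (J - F) * (moebius_cumulant m B * G (E - B) (F - B)))"
      proof (rule sum.reindex_bij_witness[of _ "\<lambda>((E, F), B). (B, E - B, F - B)"
          "\<lambda>(B, E, F). ((E \<union> (B \<inter> I), F \<union> (B \<inter> J)), B)"], goal_cases)
        case (1 x)
        then show ?case by (auto simp: \<B>_def)
      next
        case (2 x)
        then show ?case using I J disj by (auto simp: \<B>_def)
      next
        case (3 x)
        obtain E F B where x: "x = ((E, F), B)" by (metis surj_pair)
        then have "E \<subseteq> I" "F \<subseteq> J" "B \<subseteq> E \<union> F" using 3 by (auto simp: \<B>_def)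
        moreover have "I \<inter> J = {}" using I J disj by auto
        ultimately have "(E - B) \<union> (B \<inter> I) = E" "(F - B) \<union> (B \<inter> J) = F" by blast+
        then show ?case using x by simp
      next
        case (4 x)
        then show ?case by (auto simp: \<B>_def)
      next
        case (5 x)
        obtain B E F where x: "x = (B, E, F)" by (metis surj_pair)
        have B: "B \<in> \<B> I J" and E: "E \<subseteq> I - B" and F: "F \<subseteq> J - B" using 5 x by auto
        have "I - (E \<union> (B \<inter> I)) = I - B - E" "J - (F \<union> (B \<inter> J)) = J - B - F"
          "E \<union> (B \<inter> I) - B = E" "F \<union> (B \<inter> J) - B = F"
          using E F by auto
        then show ?case using x by (simp add: mult_ac)
      qed
      also have "\<dots> = (\<Sum>(E, F)\<in>Pow I \<times> Pow J. \<Sum>B\<in>\<B> E F.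
        m (I - E) * m (J - F) * (moebius_cumulant m B * G (E - B) (F - B)))"
        unfolding case_prod_unfold using finI finJ finB
        by (subst sum.Sigma) (auto simp: case_prod_unfold)
      finally show ?thesis
        by (simp add: H_def sum.cartesian_product sum_distrib_left)
    qed
    finally have "m (I \<union> J) = (\<Sum>E\<in>Pow I. (if a \<in> E then 0 else \<Sum>F\<in>Pow J. m (I - E) * m (J - F) * G E F)
       + (\<Sum>F\<in>Pow J. m (I - E) * m (J - F) * H E F))"
      by (simp add: sum.distrib)
    also have "\<dots> = (\<Sum>E\<in>Pow I. \<Sum>F\<in>Pow J. m (I - E) * m (J - F) * (G E F - d E F))"
    proof (intro sum.cong refl)
      fix E assume "E \<in> Pow I"
      \<comment> \<open>A block counted in \<open>H E F\<close> contains \<open>a\<close> and lies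
        in \<open>E \<union> F\<close>, but \<open>a\<close> is in neither set.\<close>
      have "H E F = 0" if "a \<notin> E" "F \<in> Pow J" for F
      proof -
        have "\<B> E F = {}" using that aJ by (auto simp: \<B>_def)
        then show ?thesis by (simp add: H_def)
      qed
      then show "(if a \<in> E then 0 else \<Sum>F\<in>Pow J. m (I - E) * m (J - F) * G E F)
       + (\<Sum>F\<in>Pow J. m (I - E) * m (J - F) * H E F)
       = (\<Sum>F\<in>Pow J. m (I - E) * m (J - F) * (G E F - d E F))"
        by (auto simp: d_def)
    qed
    also have "\<dots> = m (I \<union> J) - (\<Sum>E\<in>Pow I. \<Sum>F\<in>Pow J. m (I - E) * m (J - F) * d E F)"
      by (simp add: mG[OF I J] right_diff_distrib sum_subtractf)
    finally show ?thesis by simp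
  qed
  \<comment> \<open>The double convolution is inverted one variable at a time: in the first argument
    for every fixed \<open>J\<close>, then in the second.\<close>
  have "(\<Sum>F\<in>Pow J. m (J - F) * d I0 F) = 0" if J: "J \<subseteq> J0" for J
  proof (rule Pow_convolution_inject[where c = m and f = "\<lambda>E. \<Sum>F\<in>Pow J. m (J - F) * d E F" and g = "\<lambda>_. 0"])
    fix I assume "I \<subseteq> I0"
    then show "(\<Sum>E\<in>Pow I. m (I - E) * (\<Sum>F\<in>Pow J. m (J - F) * d E F)) = (\<Sum>E\<in>Pow I. m (I - E) * 0)"
      using zero[OF _ J] by (simp add: sum_distrib_left mult.assoc)
  qed (use fin m1 in auto)
  then have "d I0 J0 = 0"
    using fin m1 by (intro Pow_convolution_inject[where c = m and f = "d I0" and g = "\<lambda>_. 0"]) auto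
  then show ?thesis using a by (simp add: d_def H_def \<B>_def)
qed

section \<open>Wick polynomials\<close>

definition mom :: "'w measure \<Rightarrow> ('i \<Rightarrow> 'w \<Rightarrow> complex) \<Rightarrow> 'i set \<Rightarrow> complex" where
  "mom M Y S = integral\<^sup>L M (\<lambda>\<omega>. \<Prod>i\<in>S. Y i \<omega>)"

lemma finite_psubsets: "finite S \<Longrightarrow> finite {E. E \<subset> S}"
  by (rule finite_subset[of _ "Pow S"]) auto

declare wick_idx.simps [simp del]

lemma wick_idx_eq:
  assumes "finite S"
  shows "wick_idx M Y S \<omega> = (\<Prod>i\<in>S. Y i \<omega>) - (\<Sum>E\<in>{E. E \<subset> S}. mom M Y (S - E) * wick_idx M Y E \<omega>)"
  using assms by (simp add: mom_def wick_idx.simps[of M Y S \<omega>])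

lemma mom_reindex:
  assumes "inj_on f S"
  shows "mom M Y (f ` S) = mom M (\<lambda>i. Y (f i)) S"
  using assms by (simp add: mom_def prod.reindex)

text \<open>Needed for two shifts of the positions: by \<open>n\<close> for the second half of a
  Wick pair, and by \<open>Suc\<close> to make room for \<open>X\<close> at position 0.\<close>

lemma wick_idx_reindex:
  assumes "finite S" "inj_on f S"
  shows "wick_idx M Y (f ` S) \<omega> = wick_idx M (\<lambda>i. Y (f i)) S \<omega>"
  using assms
proof (induction S rule: finite_psubset_induct)
  case (psubset S)
  have img: "{B. B \<subset> f ` S} = (`) f ` {E. E \<subset> S}"
  proof (intro equalityI subsetI)
    fix C assume C: "C \<in> {B. B \<subset> f ` S}"
    define B where "B = {i \<in> S. f i \<in> C}"
    have "C = f ` B" "B \<subset> S" using C by (auto simp: B_def)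
    then show "C \<in> (`) f ` {E. E \<subset> S}" by auto
  next
    fix C assume "C \<in> (`) f ` {E. E \<subset> S}"
    then obtain B where "C = f ` B" "B \<subset> S" by auto
    then show "C \<in> {B. B \<subset> f ` S}"
      using inj_on_image_eq_iff[OF psubset.prems(1), of B S] by auto
  qed
  have inj: "inj_on ((`) f) {E. E \<subset> S}"
    using inj_on_image_eq_iff[OF psubset.prems(1)] by (auto intro!: inj_onI)
  have "mom M Y (f ` S - f ` E) * wick_idx M Y (f ` E) \<omega>
      = mom M (\<lambda>i. Y (f i)) (S - E) * wick_idx M (\<lambda>i. Y (f i)) E \<omega>" if E: "E \<in> {E. E \<subset> S}" for E
  proof -
    have "inj_on f E" "inj_on f (S - E)"
      using E by (auto intro: inj_on_subset[OF psubset.prems(1)])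
    moreover have "f ` S - f ` E = f ` (S - E)"
      using inj_on_image_set_diff[OF psubset.prems(1), of S E] E by auto
    moreover have "wick_idx M Y (f ` E) \<omega> = wick_idx M (\<lambda>i. Y (f i)) E \<omega>"
      using E \<open>inj_on f E\<close> by (intro psubset.IH) auto
    ultimately show ?thesis by (simp add: mom_reindex)
  qed
  then have "(\<Sum>E\<in>{E. E \<subset> S}. mom M Y (f ` S - f ` E) * wick_idx M Y (f ` E) \<omega>)
     = (\<Sum>E\<in>{E. E \<subset> S}. mom M (\<lambda>i. Y (f i)) (S - E) * wick_idx M (\<lambda>i. Y (f i)) E \<omega>)"
    by (rule sum.cong[OF refl])
  then show ?case
    by (simp add: wick_idx_eq[OF psubset.hyps] wick_idx_eq[OF finite_imageI[OF psubset.hyps]]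
        img sum.reindex[OF inj] prod.reindex[OF psubset.prems(1)])
qed

lemma wick_idx_cnj:
  assumes "finite S"
  shows "wick_idx M (\<lambda>i \<omega>. cnj (Y i \<omega>)) S \<omega> = cnj (wick_idx M Y S \<omega>)"
  using assms
proof (induction S rule: finite_psubset_induct)
  case (psubset S)
  have "mom M (\<lambda>i \<omega>. cnj (Y i \<omega>)) E = cnj (mom M Y E)" for E
    by (simp add: mom_def flip: cnj_prod integral_cnj)
  then show ?case
    using psubset by (auto simp: wick_idx_eq[OF psubset.hyps] intro!: sum.cong)
qed

lemma wick_idx_measurable:
  assumes "finite S" "\<And>i. i \<in> S \<Longrightarrow> Y i \<in> borel_measurable M"
  shows "wick_idx M Y S \<in> borel_measurable M"
  using assms
proof (induction S rule: finite_psubset_induct)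
  case (psubset S)
  have "(\<lambda>\<omega>. (\<Prod>i\<in>S. Y i \<omega>) - (\<Sum>E\<in>{E. E \<subset> S}. mom M Y (S - E) * wick_idx M Y E \<omega>))
    \<in> borel_measurable M"
    using psubset
    by (intro borel_measurable_diff borel_measurable_prod borel_measurable_sum borel_measurable_times) auto
  moreover have "wick_idx M Y S
    = (\<lambda>\<omega>. (\<Prod>i\<in>S. Y i \<omega>) - (\<Sum>E\<in>{E. E \<subset> S}. mom M Y (S - E) * wick_idx M Y E \<omega>))"
    using psubset.hyps by (intro ext wick_idx_eq)
  ultimately show ?case by simp
qed

lemma AE_prod_cong:
  assumes "finite S" "\<And>i. i \<in> S \<Longrightarrow> AE \<omega> in M. Y i \<omega> = (Y' i \<omega> :: complex)"
  shows "AE \<omega> in M. (\<Prod>i\<in>S. Y i \<omega>) = (\<Prod>i\<in>S. Y' i \<omega>)"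
proof -
  have "AE \<omega> in M. \<forall>i\<in>S. Y i \<omega> = Y' i \<omega>" using assms by (intro AE_finite_allI)
  then show ?thesis by eventually_elim simp
qed

lemma mom_cong_AE:
  assumes "finite S" "\<And>i. i \<in> S \<Longrightarrow> AE \<omega> in M. Y i \<omega> = Y' i \<omega>"
    and "\<And>i. i \<in> S \<Longrightarrow> Y i \<in> borel_measurable M" "\<And>i. i \<in> S \<Longrightarrow> Y' i \<in> borel_measurable M"
  shows "mom M Y S = mom M Y' S"
  unfolding mom_def using assms by (intro integral_cong_AE borel_measurable_prod AE_prod_cong) auto

text \<open>Closure under conjugation is an almost sure identity for each point separately; as
  \<open>S\<close> is finite, the exceptional null sets of its factors can be united.\<close>

lemma wick_idx_cong_AE:
  assumes "finite S" "\<And>i. i \<in> S \<Longrightarrow> AE \<omega> in M. Y i \<omega> = Y' i \<omega>"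
    and "\<And>i. i \<in> S \<Longrightarrow> Y i \<in> borel_measurable M" "\<And>i. i \<in> S \<Longrightarrow> Y' i \<in> borel_measurable M"
  shows "AE \<omega> in M. wick_idx M Y S \<omega> = wick_idx M Y' S \<omega>"
  using assms
proof (induction S rule: finite_psubset_induct)
  case (psubset S)
  have mom: "mom M Y (S - E) = mom M Y' (S - E)" for E
    using psubset by (intro mom_cong_AE) auto
  have "AE \<omega> in M. \<forall>E\<in>{E. E \<subset> S}. wick_idx M Y E \<omega> = wick_idx M Y' E \<omega>"
  proof (rule AE_finite_allI)
    show "finite {E. E \<subset> S}" using psubset.hyps by (rule finite_psubsets)
    fix E assume "E \<in> {E. E \<subset> S}"
    then have E: "E \<subset> S" by simp
    show "AE \<omega> in M. wick_idx M Y E \<omega> = wick_idx M Y' E \<omega>"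
      using psubset.prems E by (intro psubset.IH[OF E]) auto
  qed
  moreover have "AE \<omega> in M. (\<Prod>i\<in>S. Y i \<omega>) = (\<Prod>i\<in>S. Y' i \<omega>)"
    using psubset by (intro AE_prod_cong) auto
  ultimately show ?case
  proof eventually_elim
    case (elim \<omega>)
    then show ?case by (auto simp: wick_idx_eq[OF psubset.hyps] mom intro!: sum.cong)
  qed
qed

lemma mom_cong:
  assumes "\<And>i. i \<in> S \<Longrightarrow> Y i = Y' i"
  shows "mom M Y S = mom M Y' S"
  unfolding mom_def using assms by (auto intro!: Bochner_Integration.integral_cong prod.cong)

lemma wick_idx_cong:
  assumes "finite S" "\<And>i. i \<in> S \<Longrightarrow> Y i = Y' i"
  shows "wick_idx M Y S \<omega> = wick_idx M Y' S \<omega>"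
  using assms
proof (induction S rule: finite_psubset_induct)
  case (psubset S)
  have "mom M Y (S - E) * wick_idx M Y E \<omega> = mom M Y' (S - E) * wick_idx M Y' E \<omega>"
    if "E \<subset> S" for E
  proof -
    have "mom M Y (S - E) = mom M Y' (S - E)" using psubset.prems by (intro mom_cong) auto
    moreover have "wick_idx M Y E \<omega> = wick_idx M Y' E \<omega>"
      using psubset.prems that by (intro psubset.IH) auto
    ultimately show ?thesis by simp
  qed
  moreover have "(\<Prod>i\<in>S. Y i \<omega>) = (\<Prod>i\<in>S. Y' i \<omega>)" using psubset.prems by (intro prod.cong) auto
  ultimately show ?case
    using psubset.hyps by (auto simp: wick_idx_eq[OF psubset.hyps] intro!: sum.cong)
qed

text \<open>The factor \<open>h\<close> is kept general because it will be 1, a product of field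
  values, another Wick polynomial, or \<open>X\<close>.\<close>

lemma integrable_mult_wick_idx:
  assumes "finite S" "\<And>E. E \<subseteq> S \<Longrightarrow> integrable M (\<lambda>\<omega>. h \<omega> * (\<Prod>i\<in>E. Y i \<omega>))"
  shows "integrable M (\<lambda>\<omega>. h \<omega> * wick_idx M Y S \<omega>)"
  using assms
proof (induction S rule: finite_psubset_induct)
  case (psubset S)
  have "integrable M (\<lambda>\<omega>. h \<omega> * (\<Prod>i\<in>S. Y i \<omega>)
      - (\<Sum>E\<in>{E. E \<subset> S}. mom M Y (S - E) * (h \<omega> * wick_idx M Y E \<omega>)))"
  proof (intro Bochner_Integration.integrable_diff Bochner_Integration.integrable_sum integrable_mult_right)
    fix E assume "E \<in> {E. E \<subset> S}"
    then have E: "E \<subset> S" by simp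
    show "integrable M (\<lambda>\<omega>. h \<omega> * wick_idx M Y E \<omega>)"
      using psubset.prems E by (intro psubset.IH[OF E]) auto
  qed (use psubset in auto)
  then show ?case
    by (simp add: wick_idx_eq[OF psubset.hyps] right_diff_distrib sum_distrib_left mult_ac)
qed

section \<open>Expectations of products with Wick polynomials\<close>

context prob_space
begin

lemma mom_empty [simp]: "mom M Y {} = 1"
  by (simp add: mom_def prob_space)

lemma wick_idx_empty [simp]: "wick_idx M Y {} \<omega> = 1"
  by (simp add: wick_idx_eq)

text \<open>The recursive definition, with all Wick terms on one side, is a convolution with the
  moments. In this form it feeds \<open>Pow_convolution_inject\<close>.\<close>

lemma prod_eq_wick_sum:
  assumes "finite S"
  shows "(\<Prod>i\<in>S. Y i \<omega>) = (\<Sum>E\<in>Pow S. mom M Y (S - E) * wick_idx M Y E \<omega>)"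
proof -
  have "Pow S = insert S {E. E \<subset> S}" by auto
  then show ?thesis using assms wick_idx_eq[OF assms, of M Y \<omega>]
    by (simp add: finite_psubsets)
qed

lemma integral_mult_prod_eq_wick_sum:
  assumes S: "finite S" and int: "\<And>E. E \<subseteq> S \<Longrightarrow> integrable M (\<lambda>\<omega>. h \<omega> * (\<Prod>i\<in>E. Y i \<omega>))"
  shows "integral\<^sup>L M (\<lambda>\<omega>. h \<omega> * (\<Prod>i\<in>S. Y i \<omega>))
    = (\<Sum>E\<in>Pow S. mom M Y (S - E) * integral\<^sup>L M (\<lambda>\<omega>. h \<omega> * wick_idx M Y E \<omega>))"
proof -
  have intW: "integrable M (\<lambda>\<omega>. h \<omega> * wick_idx M Y E \<omega>)" if "E \<in> Pow S" for E
    using that S int by (intro integrable_mult_wick_idx) (auto intro: finite_subset)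
  have "(\<lambda>\<omega>. h \<omega> * (\<Prod>i\<in>S. Y i \<omega>))
      = (\<lambda>\<omega>. \<Sum>E\<in>Pow S. mom M Y (S - E) * (h \<omega> * wick_idx M Y E \<omega>))"
    by (simp add: prod_eq_wick_sum[OF S] sum_distrib_left mult_ac)
  then show ?thesis
    using intW by (simp add: Bochner_Integration.integral_sum)
qed

text \<open>The means of the Wick polynomials convolve with the moments to \<open>mom M Y T\<close>
  (the Wick expansion with \<open>h = 1\<close>); so does the function that is 1 at
  \<open>{}\<close> and 0 elsewhere.\<close>

lemma integral_wick_idx_eq_0:
  assumes S: "finite S" "S \<noteq> {}" and int: "\<And>E. E \<subseteq> S \<Longrightarrow> integrable M (\<lambda>\<omega>. \<Prod>i\<in>E. Y i \<omega>)"
  shows "integral\<^sup>L M (wick_idx M Y S) = 0"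
proof -
  define f where "f E = integral\<^sup>L M (wick_idx M Y E)" for E
  have "f S = (if S = {} then 1 else 0)"
  proof (rule Pow_convolution_inject[where c = "mom M Y" and g = "\<lambda>S. if S = {} then 1 else 0"])
    fix T assume T: "T \<subseteq> S"
    then have fin: "finite T" using S finite_subset by auto
    have "(\<Sum>E\<in>Pow T. mom M Y (T - E) * (if E = {} then 1 else 0))
       = (\<Sum>E\<in>Pow T. if E = {} then mom M Y T else 0)"
      by (intro sum.cong) auto
    also have "\<dots> = mom M Y T" using fin by (simp add: sum.delta)
    also have "\<dots> = (\<Sum>E\<in>Pow T. mom M Y (T - E) * f E)"
      using integral_mult_prod_eq_wick_sum[OF fin, of "\<lambda>_. 1" Y] int T
      by (simp add: mom_def f_def)
    finally show "(\<Sum>E\<in>Pow T. mom M Y (T - E) * f E)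
      = (\<Sum>E\<in>Pow T. mom M Y (T - E) * (if E = {} then 1 else 0))" by simp
  qed (use S in auto)
  then show ?thesis using S by (simp add: f_def)
qed

text \<open>As functions of \<open>J\<close>, both sides convolve with the moments to the mean of
  \<open>Y a\<close> times the product over \<open>T\<close>: the left one by the moment recursion
  at \<open>a\<close>, whose blocks are the sets \<open>insert a E\<close>, the right one by the
  Wick expansion against \<open>Y a\<close>.\<close>

lemma cumulant_insert_eq_integral_wick:
  assumes J: "finite J" "a \<notin> J"
    and int: "\<And>E. E \<subseteq> J \<Longrightarrow> integrable M (\<lambda>\<omega>. Y a \<omega> * (\<Prod>i\<in>E. Y i \<omega>))"
  shows "moebius_cumulant (mom M Y) (insert a J) = integral\<^sup>L M (\<lambda>\<omega>. Y a \<omega> * wick_idx M Y J \<omega>)"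
proof (rule Pow_convolution_inject[where c = "mom M Y" and f = "\<lambda>J. moebius_cumulant (mom M Y) (insert a J)"])
  fix T assume T: "T \<subseteq> J"
  then have fin: "finite T" and aT: "a \<notin> T" using J finite_subset by auto
  have img: "{B. a \<in> B \<and> B \<subseteq> insert a T} = insert a ` Pow T"
  proof (intro equalityI subsetI)
    fix B assume "B \<in> {B. a \<in> B \<and> B \<subseteq> insert a T}"
    then have "B = insert a (B - {a})" "B - {a} \<in> Pow T" by auto
    then show "B \<in> insert a ` Pow T" by (rule image_eqI)
  qed auto
  have inj: "inj_on (insert a) (Pow T)"
    using aT by (intro inj_onI) (auto simp: insert_eq_iff)
  have "(\<Sum>E\<in>Pow T. mom M Y (T - E) * moebius_cumulant (mom M Y) (insert a E))
      = (\<Sum>B\<in>insert a ` Pow T. moebius_cumulant (mom M Y) B * mom M Y (insert a T - B))"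
    unfolding sum.reindex[OF inj] 
  proof (intro sum.cong refl)
    fix E
    have "insert a T - insert a E = T - E" using aT by auto
    then show "mom M Y (T - E) * moebius_cumulant (mom M Y) (insert a E)
       = ((\<lambda>B. moebius_cumulant (mom M Y) B * mom M Y (insert a T - B)) \<circ> insert a) E"
      by simp
  qed
  also have "\<dots> = mom M Y (insert a T)"
    unfolding img[symmetric] using fin by (intro moment_cumulant_recursion[symmetric]) auto
  also have "\<dots> = integral\<^sup>L M (\<lambda>\<omega>. Y a \<omega> * (\<Prod>i\<in>T. Y i \<omega>))"
    using fin aT by (simp add: mom_def)
  also have "\<dots> = (\<Sum>E\<in>Pow T. mom M Y (T - E) * integral\<^sup>L M (\<lambda>\<omega>. Y a \<omega> * wick_idx M Y E \<omega>))"
    using T int by (intro integral_mult_prod_eq_wick_sum fin) auto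
  finally show "(\<Sum>E\<in>Pow T. mom M Y (T - E) * moebius_cumulant (mom M Y) (insert a E))
    = (\<Sum>E\<in>Pow T. mom M Y (T - E) * integral\<^sup>L M (\<lambda>\<omega>. Y a \<omega> * wick_idx M Y E \<omega>))" .
qed (use J in auto)

lemma integrable_wick_pair:
  assumes fin: "finite I" "finite J" and disj: "I \<inter> J = {}"
    and int: "\<And>E. E \<subseteq> I \<union> J \<Longrightarrow> integrable M (\<lambda>\<omega>. \<Prod>i\<in>E. Y i \<omega>)"
  shows "E \<subseteq> I \<Longrightarrow> integrable M (\<lambda>\<omega>. (\<Prod>i\<in>E. Y i \<omega>) * wick_idx M Y J \<omega>)"
    and "integrable M (\<lambda>\<omega>. wick_idx M Y I \<omega> * wick_idx M Y J \<omega>)"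
proof -
  have *: "integrable M (\<lambda>\<omega>. (\<Prod>i\<in>E. Y i \<omega>) * wick_idx M Y J \<omega>)" if E: "E \<subseteq> I" for E
  proof (rule integrable_mult_wick_idx[OF fin(2)])
    fix F assume F: "F \<subseteq> J"
    have "(\<Prod>i\<in>E. Y i \<omega>) * (\<Prod>i\<in>F. Y i \<omega>) = (\<Prod>i\<in>E \<union> F. Y i \<omega>)" for \<omega>
      using E F fin disj by (intro prod.union_disjoint[symmetric]) (auto intro: finite_subset)
    then show "integrable M (\<lambda>\<omega>. (\<Prod>i\<in>E. Y i \<omega>) * (\<Prod>i\<in>F. Y i \<omega>))"
      using int[of "E \<union> F"] E F by auto
  qed
  then show "E \<subseteq> I \<Longrightarrow> integrable M (\<lambda>\<omega>. (\<Prod>i\<in>E. Y i \<omega>) * wick_idx M Y J \<omega>)" .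
  have "integrable M (\<lambda>\<omega>. wick_idx M Y J \<omega> * wick_idx M Y I \<omega>)"
    using * by (intro integrable_mult_wick_idx fin) (simp add: mult.commute)
  then show "integrable M (\<lambda>\<omega>. wick_idx M Y I \<omega> * wick_idx M Y J \<omega>)"
    by (simp add: mult.commute)
qed

text \<open>The pair expectations satisfy \<open>mG\<close> of \<open>pair_moment_recursion\<close>:
  the product over \<open>J\<close> is expanded into Wick polynomials, then the product over
  \<open>I\<close> against each of these.\<close>

lemma wick_pair_recursion:
  assumes fin: "finite I0" "finite J0" and disj: "I0 \<inter> J0 = {}" and a: "a \<in> I0"
    and int: "\<And>E. E \<subseteq> I0 \<union> J0 \<Longrightarrow> integrable M (\<lambda>\<omega>. \<Prod>i\<in>E. Y i \<omega>)"
  shows "integral\<^sup>L M (\<lambda>\<omega>. wick_idx M Y I0 \<omega> * wick_idx M Y J0 \<omega>)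
     = (\<Sum>B\<in>{B. a \<in> B \<and> B \<subseteq> I0 \<union> J0 \<and> B \<inter> J0 \<noteq> {}}. moebius_cumulant (mom M Y) B *
          integral\<^sup>L M (\<lambda>\<omega>. wick_idx M Y (I0 - B) \<omega> * wick_idx M Y (J0 - B) \<omega>))"
proof (rule pair_moment_recursion[OF fin disj a,
    where G = "\<lambda>I J. integral\<^sup>L M (\<lambda>\<omega>. wick_idx M Y I \<omega> * wick_idx M Y J \<omega>)"])
  fix I J assume I: "I \<subseteq> I0" and J: "J \<subseteq> J0"
  have finI: "finite I" and finJ: "finite J" using I J fin finite_subset by auto
  have IJ: "I \<inter> J = {}" using I J disj by auto
  have int': "integrable M (\<lambda>\<omega>. \<Prod>i\<in>E. Y i \<omega>)" if "E \<subseteq> I \<union> J" for E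
    using that I J by (intro int) auto
  have "mom M Y (I \<union> J) = integral\<^sup>L M (\<lambda>\<omega>. (\<Prod>i\<in>I. Y i \<omega>) * (\<Prod>i\<in>J. Y i \<omega>))"
    using finI finJ IJ by (simp add: mom_def prod.union_disjoint)
  also have "\<dots> = (\<Sum>F\<in>Pow J. mom M Y (J - F) * integral\<^sup>L M (\<lambda>\<omega>. (\<Prod>i\<in>I. Y i \<omega>) * wick_idx M Y F \<omega>))"
  proof (rule integral_mult_prod_eq_wick_sum[OF finJ])
    fix F assume F: "F \<subseteq> J"
    have "(\<Prod>i\<in>I. Y i \<omega>) * (\<Prod>i\<in>F. Y i \<omega>) = (\<Prod>i\<in>I \<union> F. Y i \<omega>)" for \<omega>
      using F finI finJ IJ by (intro prod.union_disjoint[symmetric]) (auto intro: finite_subset)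
    then show "integrable M (\<lambda>\<omega>. (\<Prod>i\<in>I. Y i \<omega>) * (\<Prod>i\<in>F. Y i \<omega>))"
      using int'[of "I \<union> F"] F by auto
  qed
  also have "\<dots> = (\<Sum>F\<in>Pow J. \<Sum>E\<in>Pow I. mom M Y (I - E) * mom M Y (J - F) *
       integral\<^sup>L M (\<lambda>\<omega>. wick_idx M Y E \<omega> * wick_idx M Y F \<omega>))"
  proof (intro sum.cong refl)
    fix F assume F: "F \<in> Pow J"
    have "integral\<^sup>L M (\<lambda>\<omega>. wick_idx M Y F \<omega> * (\<Prod>i\<in>I. Y i \<omega>))
      = (\<Sum>E\<in>Pow I. mom M Y (I - E) * integral\<^sup>L M (\<lambda>\<omega>. wick_idx M Y F \<omega> * wick_idx M Y E \<omega>))"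
    proof (rule integral_mult_prod_eq_wick_sum[OF finI])
      fix E assume "E \<subseteq> I"
      then have "integrable M (\<lambda>\<omega>. (\<Prod>i\<in>E. Y i \<omega>) * wick_idx M Y F \<omega>)"
        using F finI finJ IJ by (intro integrable_wick_pair(1)[of I F] int') (auto intro: finite_subset)
      then show "integrable M (\<lambda>\<omega>. wick_idx M Y F \<omega> * (\<Prod>i\<in>E. Y i \<omega>))"
        by (simp add: mult.commute)
    qed
    then show "mom M Y (J - F) * integral\<^sup>L M (\<lambda>\<omega>. (\<Prod>i\<in>I. Y i \<omega>) * wick_idx M Y F \<omega>)
      = (\<Sum>E\<in>Pow I. mom M Y (I - E) * mom M Y (J - F) *
          integral\<^sup>L M (\<lambda>\<omega>. wick_idx M Y E \<omega> * wick_idx M Y F \<omega>))"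
      by (simp add: sum_distrib_left mult_ac)
  qed
  also have "\<dots> = (\<Sum>E\<in>Pow I. \<Sum>F\<in>Pow J. mom M Y (I - E) * mom M Y (J - F) *
       integral\<^sup>L M (\<lambda>\<omega>. wick_idx M Y E \<omega> * wick_idx M Y F \<omega>))"
    by (rule sum.swap)
  finally show "mom M Y (I \<union> J) = \<dots>" .
qed simp

end

section \<open>Discrete \<open>\<ell>\<^sub>p\<close> norms and counting of blocks\<close>

lemma cumulant_eq_moebius:
  "cumulant M Ys = moebius_cumulant (mom M (\<lambda>i. Ys ! i)) {..<length Ys}"
  by (simp add: cumulant_def moebius_cumulant_def mom_def)

text \<open>Cumulants are symmetric, so any enumeration \<open>l\<close> of the index set will do.
  This allows a chosen factor to stand at the head of the list, where the clustering norm has its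
  fixed point.\<close>

lemma moebius_cumulant_set_eq_cumulant:
  assumes "prob_space M" "distinct l" "l \<noteq> []"
  shows "moebius_cumulant (mom M Y) (set l) = cumulant M (map Y l)"
proof -
  interpret prob_space M by fact
  have inj: "inj_on ((!) l) {..<length l}" using assms by (simp add: inj_on_nth)
  have "set l = (!) l ` {..<length l}" by (auto simp: set_conv_nth)
  then have "moebius_cumulant (mom M Y) (set l)
     = moebius_cumulant (\<lambda>B. mom M Y ((!) l ` B)) {..<length l}"
    using moebius_cumulant_reindex[OF _ _ inj, of "mom M Y"] assms by (auto simp: lessThan_empty_iff)
  also have "\<dots> = moebius_cumulant (mom M (\<lambda>i. map Y l ! i)) {..<length l}"
  proof (rule moebius_cumulant_cong)
    fix B assume B: "B \<subseteq> {..<length l}"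
    then have "mom M Y ((!) l ` B) = mom M (\<lambda>i. Y (l ! i)) B"
      using inj inj_on_subset by (intro mom_reindex) blast
    also have "\<dots> = mom M (\<lambda>i. map Y l ! i) B"
      using B by (intro mom_cong) auto
    finally show "mom M Y ((!) l ` B) = mom M (\<lambda>i. map Y l ! i) B" .
  qed
  finally show ?thesis by (simp add: cumulant_eq_moebius)
qed

definition lp_norm :: "real \<Rightarrow> 'x set \<Rightarrow> ('x \<Rightarrow> complex) \<Rightarrow> real" where
  "lp_norm p A f = (\<Sum>x\<in>A. cmod (f x) powr p) powr (1 / p)"

lemma lp_norm_nonneg [simp]: "lp_norm p A f \<ge> 0"
  by (simp add: lp_norm_def)

lemma lp_norm_1: "lp_norm 1 A f = (\<Sum>x\<in>A. cmod (f x))"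
  by (simp add: lp_norm_def sum_nonneg)

lemma lp_norm_2: "lp_norm 2 A f = L2_set (\<lambda>x. cmod (f x)) A"
  by (simp add: lp_norm_def L2_set_def powr_half_sqrt sum_nonneg)

lemma lp_norm_add:
  assumes "p = 1 \<or> p = 2"
  shows "lp_norm p A (\<lambda>x. f x + g x) \<le> lp_norm p A f + lp_norm p A g"
  using assms
proof
  assume "p = 1"
  then show ?thesis by (simp add: lp_norm_1 sum.distrib[symmetric] sum_mono norm_triangle_ineq)
next
  assume p: "p = 2"
  have "L2_set (\<lambda>x. cmod (f x + g x)) A \<le> L2_set (\<lambda>x. cmod (f x) + cmod (g x)) A"
    by (intro L2_set_mono norm_triangle_ineq) auto
  also have "\<dots> \<le> L2_set (\<lambda>x. cmod (f x)) A + L2_set (\<lambda>x. cmod (g x)) A"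
    by (rule L2_set_triangle_ineq)
  finally show ?thesis by (simp add: p lp_norm_2)
qed

lemma lp_norm_sum:
  assumes "p = 1 \<or> p = 2"
  shows "lp_norm p A (\<lambda>x. \<Sum>i\<in>I. f i x) \<le> (\<Sum>i\<in>I. lp_norm p A (f i))"
proof (induction I rule: infinite_finite_induct)
  case (insert i I)
  then show ?case using lp_norm_add[OF assms, of A "f i" "\<lambda>x. \<Sum>i\<in>I. f i x"] by simp
qed (use assms in \<open>auto simp: lp_norm_def\<close>)

lemma sum_PiE_Un:
  fixes f g :: "('i \<Rightarrow> 'z) \<Rightarrow> real"
  assumes AB: "A \<inter> B = {}" 
    and f: "\<And>x y. (\<And>i. i \<in> A \<Longrightarrow> x i = y i) \<Longrightarrow> f x = f y"
    and g: "\<And>x y. (\<And>i. i \<in> B \<Longrightarrow> x i = y i) \<Longrightarrow> g x = g y"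
  shows "(\<Sum>x\<in>PiE (A \<union> B) (\<lambda>_. Z). f x * g x) = (\<Sum>x\<in>PiE A (\<lambda>_. Z). f x) * (\<Sum>x\<in>PiE B (\<lambda>_. Z). g x)"
proof -
  have "(\<Sum>x\<in>PiE (A \<union> B) (\<lambda>_. Z). f x * g x)
      = (\<Sum>(u, v)\<in>PiE A (\<lambda>_. Z) \<times> PiE B (\<lambda>_. Z). f u * g v)"
  proof (rule sum.reindex_bij_witness[of _ "\<lambda>(u, v) i. if i \<in> A then u i else v i"
      "\<lambda>x. (restrict x A, restrict x B)"], goal_cases)
    case (1 x)
    then have "(if i \<in> A then restrict x A i else restrict x B i) = x i" for i
      using PiE_arb[OF 1, of i] by simp
    then show ?case by (simp add: fun_eq_iff)
  next
    case (2 x)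
    then show ?case by auto
  next
    case (3 y)
    obtain u v where y: "y = (u, v)" by force
    then have uv: "u \<in> PiE A (\<lambda>_. Z)" "v \<in> PiE B (\<lambda>_. Z)" using 3 by auto
    have "restrict (\<lambda>i. if i \<in> A then u i else v i) A i = u i"
      "restrict (\<lambda>i. if i \<in> A then u i else v i) B i = v i" for i
      using AB PiE_arb[OF uv(1), of i] PiE_arb[OF uv(2), of i] by (auto simp: restrict_def)
    then show ?case by (simp add: y fun_eq_iff)
  next
    case (4 y)
    obtain u v where y: "y = (u, v)" by force
    then have "u \<in> PiE A (\<lambda>_. Z)" "v \<in> PiE B (\<lambda>_. Z)" using 4 by auto
    then show ?case by (auto simp: y PiE_iff extensional_def)
  next
    case (5 x)
    have "f (restrict x A) = f x" by (rule f) simp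
    moreover have "g (restrict x B) = g x" by (rule g) simp
    ultimately show ?case by simp
  qed
  then show ?thesis by (simp add: sum_product sum.cartesian_product)
qed

text \<open>This is why points are summed over full product sets: the cumulant of a block and the
  remaining Wick pair depend on disjoint sets of coordinates, so the norm of their product splits
  exactly.\<close>

lemma lp_norm_PiE_mult:
  assumes "A \<inter> B = {}"
    and "\<And>x y. (\<And>i. i \<in> A \<Longrightarrow> x i = y i) \<Longrightarrow> f x = f y"
    and "\<And>x y. (\<And>i. i \<in> B \<Longrightarrow> x i = y i) \<Longrightarrow> g x = g y"
  shows "lp_norm p (PiE (A \<union> B) (\<lambda>_. Z)) (\<lambda>x. f x * g x)
    = lp_norm p (PiE A (\<lambda>_. Z)) f * lp_norm p (PiE B (\<lambda>_. Z)) g"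
proof -
  have "(\<Sum>x\<in>PiE (A \<union> B) (\<lambda>_. Z). cmod (f x) powr p * cmod (g x) powr p)
    = (\<Sum>x\<in>PiE A (\<lambda>_. Z). cmod (f x) powr p) * (\<Sum>x\<in>PiE B (\<lambda>_. Z). cmod (g x) powr p)"
    using assms(1)
  proof (rule sum_PiE_Un)
    fix x y :: "'a \<Rightarrow> 'b"
    show "cmod (f x) powr p = cmod (f y) powr p" if "\<And>i. i \<in> A \<Longrightarrow> x i = y i"
      using assms(2)[OF that] by simp
    show "cmod (g x) powr p = cmod (g y) powr p" if "\<And>i. i \<in> B \<Longrightarrow> x i = y i"
      using assms(3)[OF that] by simp
  qed
  then show ?thesis
    by (simp add: lp_norm_def norm_mult powr_mult sum_nonneg)
qed

section \<open>Counting blocks through a fixed element\<close>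

lemma sum_Pow_card:
  fixes h :: "nat \<Rightarrow> real"
  assumes "finite V"
  shows "(\<Sum>C\<in>Pow V. h (card C)) = (\<Sum>c\<le>card V. real (card V choose c) * h c)"
proof -
  have "(\<Sum>C\<in>Pow V. h (card C)) = (\<Sum>c\<le>card V. \<Sum>C\<in>{C \<in> Pow V. card C = c}. h (card C))"
    using assms by (intro sum.group[symmetric]) (auto simp: card_mono)
  also have "\<dots> = (\<Sum>c\<le>card V. real (card V choose c) * h c)"
    using n_subsets[OF assms] by (intro sum.cong refl) simp
  finally show ?thesis .
qed

text \<open>This inequality closes the induction in \<open>wick_pair_lp_bound\<close> and is the
  origin of the base 2. The blocks with \<open>c + 1\<close> elements contribute
  \<open>fact (k - 1) * (c + 1) * 2 ^ (k - 1 - c)\<close> in total. Since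
  \<open>c + 1 \<le> 2 ^ (c + 1)\<close>, this is at most \<open>fact (k - 1) * 2 ^ k\<close>, and
  \<open>c\<close> takes \<open>k\<close> values.\<close>

lemma sum_blocks_fact_le:
  assumes U: "finite U" "a \<in> U" and k: "card U = k"
  shows "(\<Sum>B\<in>{B. a \<in> B \<and> B \<subseteq> U}. fact (card B) * (fact (k - card B) * 2 ^ (k - card B)))
     \<le> (fact k * 2 ^ k :: real)"
proof -
  define V where "V = U - {a}"
  have V: "finite V" "a \<notin> V" "card V = k - 1" using U k by (auto simp: V_def)
  have k1: "k \<ge> 1" using U k by (metis One_nat_def Suc_leI card_gt_0_iff empty_iff)
  have img: "{B. a \<in> B \<and> B \<subseteq> U} = insert a ` Pow V"
  proof (intro equalityI subsetI)
    fix B assume "B \<in> {B. a \<in> B \<and> B \<subseteq> U}"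
    then have "B = insert a (B - {a})" "B - {a} \<in> Pow V" by (auto simp: V_def)
    then show "B \<in> insert a ` Pow V" by (rule image_eqI)
  qed (use U in \<open>auto simp: V_def\<close>)
  have inj: "inj_on (insert a) (Pow V)"
    using V(2) by (intro inj_onI) (auto simp: insert_eq_iff)
  define h :: "nat \<Rightarrow> real" where "h c = fact (Suc c) * (fact (k - Suc c) * 2 ^ (k - Suc c))" for c
  have "(\<Sum>B\<in>{B. a \<in> B \<and> B \<subseteq> U}. fact (card B) * (fact (k - card B) * 2 ^ (k - card B)))
     = (\<Sum>C\<in>Pow V. h (card C))"
    unfolding img sum.reindex[OF inj]
  proof (intro sum.cong refl)
    fix C assume "C \<in> Pow V"
    then have "finite C" "a \<notin> C" using V by (auto intro: finite_subset)
    then have "card (insert a C) = Suc (card C)" by simp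
    then show "((\<lambda>B. fact (card B) * (fact (k - card B) * 2 ^ (k - card B))) \<circ> insert a) C = h (card C)"
      by (simp add: h_def)
  qed
  also have "\<dots> = (\<Sum>c\<le>k - 1. real (k - 1 choose c) * h c)"
    using sum_Pow_card[OF V(1), of h] V(3) by simp
  also have "\<dots> \<le> (\<Sum>c\<le>k - 1. fact (k - 1) * 2 ^ k)"
  proof (rule sum_mono)
    fix c assume "c \<in> {..k - 1}"
    then have c: "c \<le> k - 1" by simp
    have "real (k - 1 choose c) * h c
        = (fact c * fact (k - Suc c) * real (k - 1 choose c)) * (real (Suc c) * 2 ^ (k - Suc c))"
      by (simp add: h_def algebra_simps)
    also have "fact c * fact (k - Suc c) * real (k - 1 choose c) = fact (k - 1)"
      using arg_cong[OF binomial_fact_lemma[OF c], of real] by simp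
    also have "fact (k - 1) * (real (Suc c) * 2 ^ (k - Suc c)) \<le> fact (k - 1) * (2 ^ Suc c * 2 ^ (k - Suc c))"
      using of_nat_less_two_power[of "Suc c"] by (intro mult_left_mono mult_right_mono less_imp_le) auto
    also have "(2::real) ^ Suc c * 2 ^ (k - Suc c) = 2 ^ k"
      using c k1 by (subst power_add[symmetric]) simp
    finally show "real (k - 1 choose c) * h c \<le> fact (k - 1) * 2 ^ k" .
  qed
  also have "\<dots> = real k * fact (k - 1) * 2 ^ k" using k1 by simp
  also have "\<dots> = fact k * 2 ^ k" using k1 by (simp add: fact_reduce[of k])
  finally show ?thesis .
qed

section \<open>Clustering bounds for Wick pairs\<close>

lemma prod_eq_prod_list:
  fixes g :: "'i::linorder \<Rightarrow> complex"
  assumes "finite E"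
  shows "(\<Prod>i\<in>E. g i) = prod_list (map g (sorted_list_of_set E))"
  using prod.distinct_set_conv_list[of "sorted_list_of_set E" g] assms by simp

lemma moments_exist_prod_list:
  assumes "moments_exist M \<phi> m" "length xs \<le> m"
  shows "integrable M (\<lambda>\<omega>. prod_list (map (\<lambda>y. \<phi> y \<omega>) xs))"
proof -
  have "prod_list (map (\<lambda>y. \<phi> y \<omega>) xs) = (\<Prod>i<length xs. \<phi> (xs ! i) \<omega>)" for \<omega>
    by (simp add: prod.list_conv_set_nth atLeast0LessThan)
  then show ?thesis using assms by (simp add: moments_exist_def)
qed

lemma moments_exist_prod:
  fixes z :: "'i::linorder \<Rightarrow> 'z"
  assumes "moments_exist M \<phi> m" "finite E" "card E \<le> m"
  shows "integrable M (\<lambda>\<omega>. \<Prod>i\<in>E. \<phi> (z i) \<omega>)"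
  using moments_exist_prod_list[OF assms(1), of "map z (sorted_list_of_set E)"] assms(2,3)
  by (simp add: prod_eq_prod_list comp_def)

lemma sum_cumulant_le_clust_sum:
  assumes L: "finite L" "L \<subseteq> {xs. length xs = n - 1}"
  shows "ennreal (\<Sum>xs\<in>L. cmod (cumulant M (map \<phi> (x0 # xs))) powr p) \<le> clust_sum M \<phi> p n x0"
proof -
  define g where "g xs = ennreal (cmod (cumulant M (map \<phi> (x0 # xs))) powr p)" for xs
  have "ennreal (\<Sum>xs\<in>L. cmod (cumulant M (map \<phi> (x0 # xs))) powr p) = (\<Sum>xs\<in>L. g xs)"
    by (simp add: g_def sum_ennreal)
  also have "\<dots> = (\<Sum>xs\<in>L. if xs \<in> L then g xs else 0)" by simp
  also have "\<dots> = (\<integral>\<^sup>+ xs. (if xs \<in> L then g xs else 0) \<partial>count_space {xs. length xs = n - 1})"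
    using L by (intro nn_integral_count_space'[symmetric]) auto
  also have "\<dots> \<le> (\<integral>\<^sup>+ xs. g xs \<partial>count_space {xs. length xs = n - 1})"
    by (intro nn_integral_mono) auto
  finally show ?thesis by (simp add: clust_sum_def g_def)
qed

lemma lp_norm_cumulant_le_clust_norm:
  assumes p: "1 \<le> p" and n: "2 \<le> n" and fin: "(SUP x0. clust_sum M \<phi> p n x0) < \<infinity>"
    and L: "finite L" "L \<subseteq> {xs. length xs = n - 1}"
  shows "lp_norm p L (\<lambda>xs. cumulant M (map \<phi> (x0 # xs))) \<le> clust_norm M \<phi> p n"
proof -
  let ?s = "\<Sum>xs\<in>L. cmod (cumulant M (map \<phi> (x0 # xs))) powr p"
  have "ennreal ?s \<le> (SUP x0. clust_sum M \<phi> p n x0)"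
    using sum_cumulant_le_clust_sum[OF L] by (rule SUP_upper2[OF UNIV_I])
  \<comment> \<open>Finiteness of the supremum enters here: \<open>enn2real\<close> sends infinity
    to 0 and is monotone only below it.\<close>
  then have "enn2real (ennreal ?s) \<le> enn2real (SUP x0. clust_sum M \<phi> p n x0)"
    using fin by (intro enn2real_mono) auto
  then have "?s \<le> enn2real (SUP x0. clust_sum M \<phi> p n x0)"
    by (simp add: sum_nonneg)
  then show ?thesis
    using p n by (auto simp: lp_norm_def clust_norm_def sum_nonneg intro!: powr_mono2)
qed

lemma lp_norm_image_le:
  assumes "finite B" "inj_on e A" "e ` A \<subseteq> B" "p > 0" "\<And>x. x \<in> A \<Longrightarrow> f x = g (e x)"
  shows "lp_norm p A f \<le> lp_norm p B g"
proof -
  have "(\<Sum>x\<in>A. cmod (f x) powr p) = (\<Sum>x\<in>A. cmod (g (e x)) powr p)"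
    using assms(5) by (intro sum.cong) auto
  also have "\<dots> = (\<Sum>y\<in>e ` A. cmod (g y) powr p)"
    using assms(2) by (simp add: sum.reindex)
  also have "\<dots> \<le> (\<Sum>y\<in>B. cmod (g y) powr p)"
    using assms by (intro sum_mono2) auto
  finally show ?thesis
    using assms(4) by (auto simp: lp_norm_def sum_nonneg intro!: powr_mono2)
qed

text \<open>Since \<open>a\<close> lies outside \<open>J0\<close>, its point \<open>c a\<close> does
  not vary and serves as the fixed point of the clustering norm. Assignments on
  \<open>B \<inter> J0\<close> inject into the lists of the other \<open>card B - 1\<close> points,
  some of which may be frozen as well, so the sum is a part of the one in the norm. A common element
  of \<open>B\<close> and \<open>J0\<close> forces \<open>card B \<ge> 2\<close>.\<close>

lemma lp_norm_moebius_cumulant_le_clust_norm: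
  fixes c :: "nat \<Rightarrow> 'z" and J0 :: "nat set"
  assumes "prob_space M" and p: "1 \<le> p" and fin: "(SUP x0. clust_sum M \<phi> p (card B) x0) < \<infinity>"
    and B: "finite B" "a \<in> B" "a \<notin> J0" "B \<inter> J0 \<noteq> {}" and Z: "finite Z"
  shows "lp_norm p (PiE (B \<inter> J0) (\<lambda>_. Z))
      (\<lambda>x. moebius_cumulant (mom M (\<lambda>i. \<phi> (override_on c x J0 i))) B) \<le> clust_norm M \<phi> p (card B)"
proof -
  define l where "l = sorted_list_of_set (B - {a})"
  have l: "distinct (a # l)" "set (a # l) = B" "length l = card B - 1"
    using B by (auto simp: l_def)
  define e where "e x = map (override_on c x J0) l" for x
  let ?A = "PiE (B \<inter> J0) (\<lambda>_. Z)"
  have finA: "finite ?A" using B Z by (intro finite_PiE) auto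
  have two: "2 \<le> card B"
  proof -
    obtain b where "b \<in> B" "b \<in> J0" using B by auto
    then have "{a, b} \<subseteq> B" "a \<noteq> b" using B by auto
    then show ?thesis using card_mono[OF B(1), of "{a, b}"] by simp
  qed
  have inj: "inj_on e ?A"
  proof (rule inj_onI)
    fix x y assume x: "x \<in> ?A" and y: "y \<in> ?A" and eq: "e x = e y"
    show "x = y"
    proof (rule PiE_ext[OF x y])
      fix i assume i: "i \<in> B \<inter> J0"
      then have "i \<in> set l" using l(2) B by auto
      then have "override_on c x J0 i = override_on c y J0 i" using eq by (simp add: e_def)
      then show "x i = y i" using i by simp
    qed
  qed
  have "moebius_cumulant (mom M (\<lambda>i. \<phi> (override_on c x J0 i))) B = cumulant M (map \<phi> (c a # e x))" for x
    using moebius_cumulant_set_eq_cumulant[OF assms(1) l(1), of "\<lambda>i. \<phi> (override_on c x J0 i)"] l(2) B(3)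
    by (simp add: e_def comp_def)
  then have "lp_norm p ?A (\<lambda>x. moebius_cumulant (mom M (\<lambda>i. \<phi> (override_on c x J0 i))) B)
    \<le> lp_norm p (e ` ?A) (\<lambda>xs. cumulant M (map \<phi> (c a # xs)))"
    using inj finA p by (intro lp_norm_image_le[of _ e]) auto
  also have "\<dots> \<le> clust_norm M \<phi> p (card B)"
    using finA l(3) by (intro lp_norm_cumulant_le_clust_norm[OF p two fin]) (auto simp: e_def)
  finally show ?thesis .
qed

text \<open>The induction on \<open>I\<close> keeps \<open>J\<close> arbitrary because a peeled
  block removes indices from both sides; the bound depends only on the total number of factors. The
  hypothesis \<open>bound\<close> is all that is used of clustering.\<close>

lemma (in prob_space) wick_pair_lp_bound:
  fixes \<phi> :: "'z \<Rightarrow> 'a \<Rightarrow> complex" and c :: "nat \<Rightarrow> 'z"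
  assumes p: "p = 1 \<or> p = 2" and mom: "moments_exist M \<phi> m" and \<mu>: "0 \<le> \<mu>"
    and bound: "\<And>a B. finite B \<Longrightarrow> a \<in> B \<Longrightarrow> a \<notin> J0 \<Longrightarrow> B \<inter> J0 \<noteq> {} \<Longrightarrow> card B \<le> m \<Longrightarrow>
      lp_norm p (PiE (B \<inter> J0) (\<lambda>_. Z)) (\<lambda>x. moebius_cumulant (mom M (\<lambda>i. \<phi> (override_on c x J0 i))) B)
        \<le> fact (card B) * \<mu> ^ card B"
    and I: "finite I" "I \<inter> J0 = {}" and J: "finite J" "J \<subseteq> J0" and m: "card I + card J \<le> m"
  shows "lp_norm p (PiE J (\<lambda>_. Z))
      (\<lambda>x. integral\<^sup>L M (\<lambda>\<omega>. wick_idx M (\<lambda>i. \<phi> (override_on c x J0 i)) I \<omega> *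
                              wick_idx M (\<lambda>i. \<phi> (override_on c x J0 i)) J \<omega>))
    \<le> fact (card I + card J) * (2 * \<mu>) ^ (card I + card J)"
  using I J m
proof (induction I arbitrary: J rule: finite_psubset_induct)
  case (psubset I)
  let ?Y = "\<lambda>x i. \<phi> (override_on c x J0 i)"
  define G where "G I J x = integral\<^sup>L M (\<lambda>\<omega>. wick_idx M (?Y x) I \<omega> * wick_idx M (?Y x) J \<omega>)" for I J x
  have fin: "finite I" "finite J" using psubset.hyps psubset.prems(2) by auto
  have IJ: "I \<inter> J = {}" using psubset.prems(1,3) by auto
  have int: "integrable M (\<lambda>\<omega>. \<Prod>i\<in>E. ?Y x i \<omega>)" if E: "E \<subseteq> I \<union> J" for E x
  proof (rule moments_exist_prod[OF mom])
    show "finite E" using finite_subset[OF E] fin by simp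
    have "card E \<le> card (I \<union> J)" using E fin by (intro card_mono) auto
    also have "\<dots> \<le> card I + card J" by (rule card_Un_le)
    finally show "card E \<le> m" using psubset.prems(4) by simp
  qed
  show ?case
  proof (cases "I = {}")
    case I0: True
    show ?thesis
    proof (cases "J = {}")
      case True
      \<comment> \<open>There is just one assignment on the empty set, so the norm of the constant 1
        is 1, which is also the value of the bound for no factors.\<close>
      then show ?thesis by (simp add: I0 lp_norm_def prob_space)
    next
      case False
      have "integral\<^sup>L M (\<lambda>\<omega>. wick_idx M (?Y x) J \<omega>) = 0" for x
        using False psubset.prems(2) by (intro integral_wick_idx_eq_0 int) auto
      then show ?thesis using \<mu> by (simp add: I0 lp_norm_def)
    qed
  next
    case False
    then obtain a where a: "a \<in> I" by blast
    let ?\<B> = "{B. a \<in> B \<and> B \<subseteq> I \<union> J \<and> B \<inter> J \<noteq> {}}"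
    define k where "k = card I + card J"
    have k: "card (I \<union> J) = k" using fin IJ by (simp add: card_Un_disjoint k_def)
    have "lp_norm p (PiE J (\<lambda>_. Z)) (G I J) =
       lp_norm p (PiE J (\<lambda>_. Z)) (\<lambda>x. \<Sum>B\<in>?\<B>. moebius_cumulant (mom M (?Y x)) B * G (I - B) (J - B) x)"
      unfolding G_def using psubset.hyps psubset.prems(2) IJ a int
      by (subst wick_pair_recursion) auto
    also have "\<dots> \<le> (\<Sum>B\<in>?\<B>. lp_norm p (PiE J (\<lambda>_. Z))
        (\<lambda>x. moebius_cumulant (mom M (?Y x)) B * G (I - B) (J - B) x))"
      by (rule lp_norm_sum[OF p])
    also have "\<dots> \<le> (\<Sum>B\<in>?\<B>. \<mu> ^ k * (fact (card B) * (fact (k - card B) * 2 ^ (k - card B))))"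
    proof (rule sum_mono)
      fix B assume "B \<in> ?\<B>"
      then have B: "a \<in> B" "B \<subseteq> I \<union> J" "B \<inter> J \<noteq> {}" by auto
      have finB: "finite B" using finite_subset[OF B(2)] fin by simp
      \<comment> \<open>Indices of \<open>B\<close> outside \<open>J\<close> lie in
        \<open>I\<close>, hence outside \<open>J0\<close>, and carry fixed points. So the cumulant
        of \<open>B\<close> depends only on the coordinates in \<open>B \<inter> J\<close>.\<close>
      have BJ: "B \<inter> J0 = B \<inter> J" using B(2) psubset.prems(1,3) by auto
      have "(I - B) \<union> (J - B) = I \<union> J - B" by auto
      moreover have "card ((I - B) \<union> (J - B)) = card (I - B) + card (J - B)"
        using fin IJ by (intro card_Un_disjoint) auto
      ultimately have rest: "card (I - B) + card (J - B) = k - card B"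
        using card_Diff_subset[OF finB B(2)] k by simp
      have Bk: "card B \<le> k" using card_mono[OF _ B(2)] fin k by simp
      have J_eq: "J = (B \<inter> J) \<union> (J - B)" by auto
      have "lp_norm p (PiE J (\<lambda>_. Z)) (\<lambda>x. moebius_cumulant (mom M (?Y x)) B * G (I - B) (J - B) x)
         = lp_norm p (PiE (B \<inter> J) (\<lambda>_. Z)) (\<lambda>x. moebius_cumulant (mom M (?Y x)) B)
           * lp_norm p (PiE (J - B) (\<lambda>_. Z)) (G (I - B) (J - B))"
        unfolding arg_cong[OF J_eq, of "\<lambda>J. lp_norm p (PiE J (\<lambda>_. Z))"]
      proof (rule lp_norm_PiE_mult)
        fix x y :: "nat \<Rightarrow> 'z"
        assume eq: "\<And>i. i \<in> B \<inter> J \<Longrightarrow> x i = y i"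
        have "?Y x i = ?Y y i" if "i \<in> B" for i
        proof (cases "i \<in> J0")
          case True
          then have "i \<in> B \<inter> J" using that BJ by blast
          then show ?thesis using eq[of i] True by simp
        qed simp
        then show "moebius_cumulant (mom M (?Y x)) B = moebius_cumulant (mom M (?Y y)) B"
          by (intro moebius_cumulant_cong mom_cong) auto
      next
        fix x y :: "nat \<Rightarrow> 'z"
        assume eq: "\<And>i. i \<in> J - B \<Longrightarrow> x i = y i"
        have Yeq: "?Y x i = ?Y y i" if "i \<in> (I - B) \<union> (J - B)" for i
        proof (cases "i \<in> J0")
          case True
          then show ?thesis using eq[of i] that psubset.prems(1) by auto
        qed simp
        have "wick_idx M (?Y x) (I - B) \<omega> = wick_idx M (?Y y) (I - B) \<omega>" for \<omega>
          using psubset.hyps Yeq by (intro wick_idx_cong) auto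
        moreover have "wick_idx M (?Y x) (J - B) \<omega> = wick_idx M (?Y y) (J - B) \<omega>" for \<omega>
          using psubset.prems(2) Yeq by (intro wick_idx_cong) auto
        ultimately show "G (I - B) (J - B) x = G (I - B) (J - B) y" by (simp add: G_def)
      qed auto
      also have "\<dots> \<le> (fact (card B) * \<mu> ^ card B) * (fact (k - card B) * (2 * \<mu>) ^ (k - card B))"
      proof (rule mult_mono)
        show "lp_norm p (PiE (B \<inter> J) (\<lambda>_. Z)) (\<lambda>x. moebius_cumulant (mom M (?Y x)) B)
            \<le> fact (card B) * \<mu> ^ card B"
          using bound[of B a] finB B BJ a psubset.prems(1,4) Bk by (auto simp: k_def)
        have "I - B \<subset> I" using a B by auto
        moreover have "(I - B) \<inter> J0 = {}" "finite (J - B)" "J - B \<subseteq> J0"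
          using psubset.prems(1-3) by auto
        moreover have "card (I - B) + card (J - B) \<le> m"
          using rest psubset.prems(4) by (simp add: k_def)
        ultimately show "lp_norm p (PiE (J - B) (\<lambda>_. Z)) (G (I - B) (J - B))
            \<le> fact (k - card B) * (2 * \<mu>) ^ (k - card B)"
          unfolding rest[symmetric] G_def by (rule psubset.IH)
      qed (use \<mu> in auto)
      also have "\<dots> = \<mu> ^ k * (fact (card B) * (fact (k - card B) * 2 ^ (k - card B)))"
        using power_add[of \<mu> "card B" "k - card B"] Bk by (simp add: power_mult_distrib)
      finally show "lp_norm p (PiE J (\<lambda>_. Z)) (\<lambda>x. moebius_cumulant (mom M (?Y x)) B * G (I - B) (J - B) x)
        \<le> \<mu> ^ k * (fact (card B) * (fact (k - card B) * 2 ^ (k - card B)))" .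
    qed
    \<comment> \<open>The blocks inside \<open>I\<close> are added back, with nonnegative terms, so
      that all blocks through \<open>a\<close> are counted.\<close>
    also have "\<dots> \<le> (\<Sum>B\<in>{B. a \<in> B \<and> B \<subseteq> I \<union> J}. \<mu> ^ k * (fact (card B) * (fact (k - card B) * 2 ^ (k - card B))))"
      using fin \<mu> by (intro sum_mono2) (auto intro: finite_subset[of _ "Pow (I \<union> J)"])
    also have "\<dots> = \<mu> ^ k * (\<Sum>B\<in>{B. a \<in> B \<and> B \<subseteq> I \<union> J}. fact (card B) * (fact (k - card B) * 2 ^ (k - card B)))"
      by (simp add: sum_distrib_left)
    also have "\<dots> \<le> \<mu> ^ k * (fact k * 2 ^ k)"
      using fin a k \<mu> by (intro mult_left_mono sum_blocks_fact_le) auto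
    also have "\<dots> = fact k * (2 * \<mu>) ^ k" by (simp add: power_mult_distrib)
    finally show ?thesis by (simp add: G_def[abs_def] k_def)
  qed
qed

section \<open>From lists of points to one index set\<close>

lemma wick_map:
  "wick M (map \<phi> x) \<omega> = wick_idx M (\<lambda>i. \<phi> (x ! i)) {..<length x} \<omega>"
  unfolding wick_def length_map by (rule wick_idx_cong) auto

lemma wick_map_cnj:
  "wick M (map (\<lambda>y \<omega>. cnj (\<phi> y \<omega>)) x) \<omega> = cnj (wick M (map \<phi> x) \<omega>)"
  by (simp add: wick_map wick_idx_cnj)

lemma borel_measurable_cnj:
  assumes "f \<in> borel_measurable M"
  shows "(\<lambda>\<omega>. cnj (f \<omega>)) \<in> borel_measurable M"
  using assms by (intro borel_measurable_continuous_on[where f = cnj] continuous_intros)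

lemma wick_map_measurable:
  assumes "random_field M \<phi>"
  shows "wick M (map \<phi> x) \<in> borel_measurable M"
  unfolding wick_map[abs_def] using assms by (intro wick_idx_measurable) (auto simp: random_field_def)

lemma Phi_eq:
  "Phi M \<phi> y x = integral\<^sup>L M (\<lambda>\<omega>. cnj (wick M (map \<phi> y) \<omega>) * wick M (map \<phi> x) \<omega>)"
  by (simp add: Phi_def wick_map_cnj)

text \<open>The two Wick factors share one index set \<open>{..<2 * n}\<close>: positions below \<open>n\<close> carry the conjugated
  points of \<open>x'\<close>, the remaining ones carry \<open>x\<close>. Only the latter vary in the sums, hence \<open>override_on\<close>.\<close>

definition wick_pair_idx :: "('z \<Rightarrow> 'z) \<Rightarrow> 'z list \<Rightarrow> 'z list \<Rightarrow> nat \<Rightarrow> 'z" where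
  "wick_pair_idx s x' x = override_on (\<lambda>i. s (x' ! i)) (\<lambda>i. x ! (i - length x'))
     {length x'..<2 * length x'}"

text \<open>The map \<open>s\<close> moves the conjugation from the variables to the points, so that
  beyond this lemma only moments and cumulants of the field itself have to be estimated.\<close>

lemma wick_pair_AE:
  fixes \<phi> :: "'z \<Rightarrow> 'w \<Rightarrow> complex"
  assumes rf: "random_field M \<phi>" and s: "\<And>y. AE \<omega> in M. cnj (\<phi> y \<omega>) = \<phi> (s y) \<omega>"
    and len: "length x' = n" "length x = n"
  shows "AE \<omega> in M. cnj (wick M (map \<phi> x') \<omega>) * wick M (map \<phi> x) \<omega>
     = wick_idx M (\<lambda>i. \<phi> (wick_pair_idx s x' x i)) {..<n} \<omega>
       * wick_idx M (\<lambda>i. \<phi> (wick_pair_idx s x' x i)) {n..<2 * n} \<omega>"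
proof -
  let ?Y = "\<lambda>i. \<phi> (wick_pair_idx s x' x i)"
  have meas: "\<phi> y \<in> borel_measurable M" for y using rf by (simp add: random_field_def)
  have conj: "AE \<omega> in M. wick_idx M (\<lambda>i \<omega>. cnj (\<phi> (x' ! i) \<omega>)) {..<n} \<omega> = wick_idx M ?Y {..<n} \<omega>"
  proof (rule wick_idx_cong_AE)
    fix i assume "i \<in> {..<n}"
    then show "AE \<omega> in M. cnj (\<phi> (x' ! i) \<omega>) = ?Y i \<omega>"
      using s[of "x' ! i"] len by (simp add: wick_pair_idx_def)
  qed (use meas in \<open>auto intro: borel_measurable_cnj\<close>)
  have V: "wick M (map \<phi> x) \<omega> = wick_idx M ?Y {n..<2 * n} \<omega>" for \<omega>
  proof -
    have "{n..<2 * n} = (\<lambda>i. i + n) ` {..<n}"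
      by (simp add: lessThan_atLeast0 image_add_atLeastLessThan' mult_2)
    then have "wick_idx M ?Y {n..<2 * n} \<omega> = wick_idx M (\<lambda>i. ?Y (i + n)) {..<n} \<omega>"
      by (simp add: wick_idx_reindex)
    also have "\<dots> = wick_idx M (\<lambda>i. \<phi> (x ! i)) {..<n} \<omega>"
      using len by (intro wick_idx_cong) (auto simp: wick_pair_idx_def)
    finally show ?thesis using len by (simp add: wick_map)
  qed
  from conj show ?thesis
  proof eventually_elim
    case (elim \<omega>)
    then show ?case using len V by (simp add: wick_map[of M \<phi> x'] wick_idx_cnj)
  qed
qed

context prob_space
begin

lemma integrable_wick_pair_map:
  fixes \<phi> :: "'z \<Rightarrow> 'a \<Rightarrow> complex"
  assumes rf: "random_field M \<phi>" and s: "\<And>y. AE \<omega> in M. cnj (\<phi> y \<omega>) = \<phi> (s y) \<omega>"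
    and mom: "moments_exist M \<phi> m" and len: "length x' = n" "length x = n" and m: "2 * n \<le> m"
  shows "integrable M (\<lambda>\<omega>. cnj (wick M (map \<phi> x') \<omega>) * wick M (map \<phi> x) \<omega>)"
proof -
  let ?Y = "\<lambda>i. \<phi> (wick_pair_idx s x' x i)"
  have "integrable M (\<lambda>\<omega>. \<Prod>i\<in>E. ?Y i \<omega>)" if E: "E \<subseteq> {..<n} \<union> {n..<2 * n}" for E
  proof (rule moments_exist_prod[OF mom])
    have E2: "E \<subseteq> {..<2 * n}" using E by auto
    then show "finite E" by (rule finite_subset) simp
    show "card E \<le> m" using card_mono[OF _ E2] m by simp
  qed
  then have "integrable M (\<lambda>\<omega>. wick_idx M ?Y {..<n} \<omega> * wick_idx M ?Y {n..<2 * n} \<omega>)"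
    by (intro integrable_wick_pair(2)) auto
  moreover have "(\<lambda>\<omega>. cnj (wick M (map \<phi> x') \<omega>) * wick M (map \<phi> x) \<omega>) \<in> borel_measurable M"
    using wick_map_measurable[OF rf] by (auto intro!: borel_measurable_times borel_measurable_cnj)
  moreover have "(\<lambda>\<omega>. wick_idx M ?Y {..<n} \<omega> * wick_idx M ?Y {n..<2 * n} \<omega>) \<in> borel_measurable M"
    using rf by (intro borel_measurable_times wick_idx_measurable) (auto simp: random_field_def)
  ultimately show ?thesis
    using wick_pair_AE[OF rf s len] by (subst integrable_cong_AE)
qed

lemma lp_norm_Phi_le:
  fixes \<phi> :: "'z \<Rightarrow> 'a \<Rightarrow> complex"
  assumes rf: "random_field M \<phi>" and s: "\<And>y. AE \<omega> in M. cnj (\<phi> y \<omega>) = \<phi> (s y) \<omega>"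
    and p: "p = 1 \<or> p = 2" and clust: "clustering M \<phi> p m" and m: "2 * n \<le> m" and \<mu>: "0 \<le> \<mu>"
    and norm: "\<And>k. 2 \<le> k \<Longrightarrow> k \<le> 2 * n \<Longrightarrow> clust_norm M \<phi> p k \<le> fact k * \<mu> ^ k"
    and F: "finite F" "F \<subseteq> {x. length x = n}" and x': "length x' = n"
  shows "lp_norm p F (Phi M \<phi> x') \<le> fact (2 * n) * (2 * \<mu>) ^ (2 * n)"
proof -
  define c where "c i = s (x' ! i)" for i
  define J0 where "J0 = {n..<2 * n}"
  \<comment> \<open>\<open>F\<close> need not be a product set, but it embeds into the assignments
    from \<open>J0\<close> to the finitely many points that occur in it, a full product on which
    norms factorize.\<close>
  define Z where "Z = (\<Union>x\<in>F. set x)"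
  define e where "e x = (\<lambda>i\<in>J0. x ! (i - n))" for x :: "'z list"
  have finZ: "finite Z" using F by (simp add: Z_def)
  \<comment> \<open>Lowering the order from \<open>m\<close> to \<open>2 * n\<close> restricts the
    blocks to at most \<open>2 * n\<close> elements, the range covered by
    \<open>norm\<close>.\<close>
  have mom: "moments_exist M \<phi> (2 * n)"
    using clust m unfolding clustering_def moments_exist_def by (meson order_trans)
  have idx: "wick_pair_idx s x' x = override_on c (e x) J0" for x
    unfolding wick_pair_idx_def x' by (rule ext) (simp add: override_on_def c_def J0_def e_def)
  define G where "G y = integral\<^sup>L M (\<lambda>\<omega>. wick_idx M (\<lambda>i. \<phi> (override_on c y J0 i)) {..<n} \<omega> *
                              wick_idx M (\<lambda>i. \<phi> (override_on c y J0 i)) J0 \<omega>)" for y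
  have "Phi M \<phi> x' x = G (e x)" if "x \<in> F" for x
  proof -
    have "length x = n" using that F by auto
    from wick_pair_AE[OF rf s x' this]
    have ae: "AE \<omega> in M. cnj (wick M (map \<phi> x') \<omega>) * wick M (map \<phi> x) \<omega>
     = wick_idx M (\<lambda>i. \<phi> (override_on c (e x) J0 i)) {..<n} \<omega>
       * wick_idx M (\<lambda>i. \<phi> (override_on c (e x) J0 i)) J0 \<omega>"
      unfolding idx J0_def[symmetric] .
    show ?thesis
      unfolding Phi_eq G_def
    proof (rule integral_cong_AE[OF _ _ ae])
      show "(\<lambda>\<omega>. cnj (wick M (map \<phi> x') \<omega>) * wick M (map \<phi> x) \<omega>) \<in> borel_measurable M"
        by (intro borel_measurable_times borel_measurable_cnj wick_map_measurable rf)
      show "(\<lambda>\<omega>. wick_idx M (\<lambda>i. \<phi> (override_on c (e x) J0 i)) {..<n} \<omega>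
          * wick_idx M (\<lambda>i. \<phi> (override_on c (e x) J0 i)) J0 \<omega>) \<in> borel_measurable M"
        using rf by (intro borel_measurable_times wick_idx_measurable) (simp_all add: random_field_def J0_def)
    qed
  qed
  moreover have "inj_on e F"
  proof (rule inj_onI)
    fix x y assume x: "x \<in> F" and y: "y \<in> F" and eq: "e x = e y"
    have len: "length x = n" "length y = n" using x y F by auto
    show "x = y"
    proof (rule nth_equalityI)
      fix i assume "i < length x"
      then have "i + n \<in> J0" using len by (auto simp: J0_def)
      then show "x ! i = y ! i" using fun_cong[OF eq, of "i + n"] by (simp add: e_def)
    qed (use len in simp)
  qed
  moreover have "e ` F \<subseteq> PiE J0 (\<lambda>_. Z)"
  proof (clarsimp simp: e_def Z_def)
    fix x i assume x: "x \<in> F" and "i \<in> J0"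
    then have "i - n < length x" using F by (auto simp: J0_def)
    then show "\<exists>y\<in>F. x ! (i - n) \<in> set y" using x by (intro bexI[of _ x]) auto
  qed
  ultimately have "lp_norm p F (Phi M \<phi> x') \<le> lp_norm p (PiE J0 (\<lambda>_. Z)) G"
    using p finZ by (intro lp_norm_image_le[of _ e] finite_PiE) (auto simp: J0_def)
  also have "\<dots> \<le> fact (card {..<n} + card J0) * (2 * \<mu>) ^ (card {..<n} + card J0)"
    unfolding G_def
  proof (rule wick_pair_lp_bound[OF p mom \<mu>])
    fix a B assume B: "finite B" "a \<in> B" "a \<notin> J0" "B \<inter> J0 \<noteq> {}" "card B \<le> 2 * n"
    then obtain b where "b \<in> B" "b \<in> J0" by auto
    then have "{a, b} \<subseteq> B" "a \<noteq> b" using B by auto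
    then have two: "2 \<le> card B" using card_mono[OF B(1), of "{a, b}"] by simp
    have "lp_norm p (PiE (B \<inter> J0) (\<lambda>_. Z)) (\<lambda>x. moebius_cumulant (mom M (\<lambda>i. \<phi> (override_on c x J0 i))) B)
      \<le> clust_norm M \<phi> p (card B)"
    proof (rule lp_norm_moebius_cumulant_le_clust_norm[OF prob_space_axioms _ _ B(1-4) finZ])
      show "1 \<le> p" using p by auto
      have "card B \<le> m" using B(5) m by simp
      then show "(SUP x0. clust_sum M \<phi> p (card B) x0) < \<infinity>"
        using clust two unfolding clustering_def by blast
    qed
    also have "\<dots> \<le> fact (card B) * \<mu> ^ card B" using two B(5) by (rule norm)
    finally show "lp_norm p (PiE (B \<inter> J0) (\<lambda>_. Z)) (\<lambda>x. moebius_cumulant (mom M (\<lambda>i. \<phi> (override_on c x J0 i))) B)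
      \<le> fact (card B) * \<mu> ^ card B" .
  qed (auto simp: J0_def)
  also have "card {..<n} + card J0 = 2 * n" by (simp add: J0_def)
  finally show ?thesis .
qed

text \<open>As \<open>cmod X * cmod P\<close> is at most the sum of the two squares, it is enough
  that the product \<open>P\<close> is square integrable. By closure under conjugation, the squared
  modulus of \<open>P\<close> is almost surely the modulus of \<open>Q\<close>, a product of
  \<open>2 * card E\<close> field values, whose integrability is a moment condition.\<close>

lemma integrable_X_prod:
  fixes \<phi> :: "'z \<Rightarrow> 'a \<Rightarrow> complex" and z :: "nat \<Rightarrow> 'z"
  assumes rf: "random_field M \<phi>" and s: "\<And>y. AE \<omega> in M. cnj (\<phi> y \<omega>) = \<phi> (s y) \<omega>"
    and mom: "moments_exist M \<phi> m" and E: "finite E" "2 * card E \<le> m"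
    and X: "X \<in> borel_measurable M" "integrable M (\<lambda>\<omega>. (cmod (X \<omega>))\<^sup>2)"
  shows "integrable M (\<lambda>\<omega>. X \<omega> * (\<Prod>i\<in>E. \<phi> (z i) \<omega>))"
proof -
  define l where "l = map z (sorted_list_of_set E)"
  define P where "P \<omega> = (\<Prod>i\<in>E. \<phi> (z i) \<omega>)" for \<omega>
  have meas: "\<phi> y \<in> borel_measurable M" for y using rf by (simp add: random_field_def)
  have Pm: "P \<in> borel_measurable M" unfolding P_def[abs_def] using meas by measurable
  have Pl: "P \<omega> = prod_list (map (\<lambda>y. \<phi> y \<omega>) l)" for \<omega>
    using E by (simp add: P_def l_def prod_eq_prod_list comp_def)
  define Q where "Q \<omega> = prod_list (map (\<lambda>y. \<phi> y \<omega>) (map s l @ l))" for \<omega>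
  have Qi: "integrable M Q"
    unfolding Q_def[abs_def] using E by (intro moments_exist_prod_list[OF mom]) (simp add: l_def)
  have "AE \<omega> in M. \<forall>y\<in>set l. cnj (\<phi> y \<omega>) = \<phi> (s y) \<omega>"
    using s by (intro AE_finite_allI) auto
  then have ae: "AE \<omega> in M. cmod (Q \<omega>) = (cmod (P \<omega>))\<^sup>2"
  proof eventually_elim
    case (elim \<omega>)
    have "cnj (prod_list (map (\<lambda>y. \<phi> y \<omega>) l)) = prod_list (map (\<lambda>y. \<phi> y \<omega>) (map s l))"
      using elim by (induction l) auto
    then have "Q \<omega> = cnj (P \<omega>) * P \<omega>" by (simp add: Q_def Pl)
    then show ?case by (simp add: norm_mult power2_eq_square)
  qed
  have P2: "integrable M (\<lambda>\<omega>. (cmod (P \<omega>))\<^sup>2)"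
    using integrable_norm[OF Qi] ae Pm Qi by (subst integrable_cong_AE[of _ _ "\<lambda>\<omega>. cmod (Q \<omega>)"]) auto
  show ?thesis unfolding P_def[symmetric]
  proof (rule Bochner_Integration.integrable_bound)
    show "integrable M (\<lambda>\<omega>. (cmod (X \<omega>))\<^sup>2 + (cmod (P \<omega>))\<^sup>2)" using X P2 by simp
    have "cmod (X \<omega>) * cmod (P \<omega>) \<le> (cmod (X \<omega>))\<^sup>2 + (cmod (P \<omega>))\<^sup>2" for \<omega>
    proof -
      have "0 \<le> cmod (X \<omega>) * cmod (P \<omega>)" by simp
      then show ?thesis
        using sum_squares_bound[of "cmod (X \<omega>)" "cmod (P \<omega>)"] unfolding mult.assoc by linarith
    qed
    then show "AE \<omega> in M. norm (X \<omega> * P \<omega>) \<le> norm ((cmod (X \<omega>))\<^sup>2 + (cmod (P \<omega>))\<^sup>2)"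
      by (simp add: norm_mult)
  qed (use X Pm in measurable)
qed

lemma cumulant_eq_integral_wick:
  fixes \<phi> :: "'z \<Rightarrow> 'a \<Rightarrow> complex"
  assumes rf: "random_field M \<phi>" and s: "\<And>y. AE \<omega> in M. cnj (\<phi> y \<omega>) = \<phi> (s y) \<omega>"
    and mom: "moments_exist M \<phi> m" and x: "2 * length x \<le> m"
    and X: "X \<in> borel_measurable M" "integrable M (\<lambda>\<omega>. (cmod (X \<omega>))\<^sup>2)"
  shows "cumulant M (X # map \<phi> x) = integral\<^sup>L M (\<lambda>\<omega>. X \<omega> * wick M (map \<phi> x) \<omega>)"
    and "integrable M (\<lambda>\<omega>. X \<omega> * wick M (map \<phi> x) \<omega>)"
proof -
  let ?Y = "\<lambda>i. (X # map \<phi> x) ! i"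
  let ?n = "length x"
  have int: "integrable M (\<lambda>\<omega>. X \<omega> * (\<Prod>i\<in>E. \<phi> (x ! i) \<omega>))" if E: "E \<subseteq> {..<?n}" for E
    using card_mono[OF _ E] x finite_subset[OF E]
    by (intro integrable_X_prod[OF rf s mom _ _ X]) auto
  show "integrable M (\<lambda>\<omega>. X \<omega> * wick M (map \<phi> x) \<omega>)"
    unfolding wick_map by (intro integrable_mult_wick_idx int) auto
  \<comment> \<open>Position 0 carries \<open>X\<close>, and the Wick polynomial lives on the
    positions shifted by \<open>Suc\<close>.\<close>
  have "cumulant M (X # map \<phi> x) = moebius_cumulant (mom M ?Y) (insert 0 (Suc ` {..<?n}))"
    by (simp add: cumulant_eq_moebius lessThan_Suc_eq_insert_0)
  also have "\<dots> = integral\<^sup>L M (\<lambda>\<omega>. ?Y 0 \<omega> * wick_idx M ?Y (Suc ` {..<?n}) \<omega>)"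
  proof (rule cumulant_insert_eq_integral_wick)
    fix E assume "E \<subseteq> Suc ` {..<?n}"
    then obtain D where D: "D \<subseteq> {..<?n}" "E = Suc ` D" by (auto simp: subset_image_iff)
    then have "(\<Prod>i\<in>E. ?Y i \<omega>) = (\<Prod>i\<in>D. \<phi> (x ! i) \<omega>)" for \<omega>
      by (auto simp: prod.reindex intro!: prod.cong)
    then show "integrable M (\<lambda>\<omega>. ?Y 0 \<omega> * (\<Prod>i\<in>E. ?Y i \<omega>))" using int[OF D(1)] by simp
  qed auto
  also have "wick_idx M ?Y (Suc ` {..<?n}) = wick M (map \<phi> x)"
    by (rule ext) (simp add: wick_idx_reindex wick_def)
  finally show "cumulant M (X # map \<phi> x) = integral\<^sup>L M (\<lambda>\<omega>. X \<omega> * wick M (map \<phi> x) \<omega>)"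
    by simp
qed

end

section \<open>Weighted Bessel inequality and the cumulant sums\<close>

text \<open>For \<open>C > 0\<close> the choice \<open>t = C\<close> gives
  \<open>2 * S \<le> C * A + S\<close>, without square roots or a separate case
  \<open>A = 0\<close>. For \<open>C = 0\<close> a small \<open>t\<close> is required: with
  \<open>t = S / (A + 1)\<close> a positive \<open>S\<close> would satisfy
  \<open>2 * S \<le> S\<close>.\<close>

lemma le_mult_of_scaled_mean_le:
  fixes S A C :: real
  assumes "0 \<le> A" "0 \<le> C" and le: "\<And>t. 0 < t \<Longrightarrow> 2 * S \<le> t * A + S * C / t"
  shows "S \<le> C * A"
proof (cases "C = 0")
  case True
  show ?thesis
  proof (rule ccontr)
    assume "\<not> S \<le> C * A"
    then have S: "S > 0" using True by simp
    then have "S / (A + 1) > 0" using assms by simp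
    then have "2 * S \<le> S / (A + 1) * A" using le[of "S / (A + 1)"] True by simp
    also have "\<dots> \<le> S" using assms S by (simp add: field_simps)
    finally show False using S by simp
  qed
next
  case False
  then show ?thesis using le[of C] assms by simp
qed

text \<open>The row condition on \<open>C\<close> weights only the index summed over. The weight of
  the other index goes into \<open>S\<close>, so that the mean square of \<open>h\<close> is at most
  \<open>S * C\<close>, with the same \<open>S\<close> as in the pairing of \<open>X0\<close> with
  \<open>h\<close>.\<close>

lemma weighted_bessel:
  fixes V :: "'x \<Rightarrow> 'w \<Rightarrow> complex" and X0 :: "'w \<Rightarrow> complex" and w :: "'x \<Rightarrow> real"
  assumes F: "finite F" and w: "\<And>x. 0 \<le> w x"
    and X0: "integrable M (\<lambda>\<omega>. (cmod (X0 \<omega>))\<^sup>2)"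
    and XV: "\<And>x. x \<in> F \<Longrightarrow> integrable M (\<lambda>\<omega>. X0 \<omega> * V x \<omega>)"
    and VV: "\<And>x y. x \<in> F \<Longrightarrow> y \<in> F \<Longrightarrow> integrable M (\<lambda>\<omega>. cnj (V y \<omega>) * V x \<omega>)"
    and C: "0 \<le> C" "\<And>x. x \<in> F \<Longrightarrow> (\<Sum>y\<in>F. w y * cmod (integral\<^sup>L M (\<lambda>\<omega>. cnj (V x \<omega>) * V y \<omega>))) \<le> C"
  shows "(\<Sum>x\<in>F. w x * (cmod (integral\<^sup>L M (\<lambda>\<omega>. X0 \<omega> * V x \<omega>)))\<^sup>2)
     \<le> C * integral\<^sup>L M (\<lambda>\<omega>. (cmod (X0 \<omega>))\<^sup>2)"
proof -
  define k where "k x = integral\<^sup>L M (\<lambda>\<omega>. X0 \<omega> * V x \<omega>)" for x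
  define P where "P y x = integral\<^sup>L M (\<lambda>\<omega>. cnj (V y \<omega>) * V x \<omega>)" for y x
  define S where "S = (\<Sum>x\<in>F. w x * (cmod (k x))\<^sup>2)"
  define A where "A = integral\<^sup>L M (\<lambda>\<omega>. (cmod (X0 \<omega>))\<^sup>2)"
  define h where "h \<omega> = (\<Sum>x\<in>F. of_real (w x) * cnj (k x) * V x \<omega>)" for \<omega>
  have S0: "S \<ge> 0" using w by (auto simp: S_def intro!: sum_nonneg)
  have A0: "A \<ge> 0" by (simp add: A_def)
  have P_commute: "cmod (P y x) = cmod (P x y)" for x y
  proof -
    have "P y x = cnj (P x y)"
      unfolding P_def by (subst Bochner_Integration.integral_cnj[symmetric]) (simp add: mult.commute)
    then show ?thesis by simp
  qed
  have Xh: "X0 \<omega> * h \<omega> = (\<Sum>x\<in>F. of_real (w x) * cnj (k x) * (X0 \<omega> * V x \<omega>))" for \<omega>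
    by (simp add: h_def sum_distrib_left mult_ac)
  have int_Xh: "integrable M (\<lambda>\<omega>. X0 \<omega> * h \<omega>)"
    unfolding Xh using XV by auto
  have "integral\<^sup>L M (\<lambda>\<omega>. X0 \<omega> * h \<omega>) = (\<Sum>x\<in>F. of_real (w x) * cnj (k x) * k x)"
    unfolding Xh using XV by (simp add: Bochner_Integration.integral_sum k_def)
  also have "\<dots> = of_real S"
    unfolding S_def of_real_sum
    by (intro sum.cong refl) (simp add: complex_norm_square mult_ac del: of_real_power)
  finally have S_eq: "integral\<^sup>L M (\<lambda>\<omega>. X0 \<omega> * h \<omega>) = of_real S" .
  have hh: "cnj (h \<omega>) * h \<omega> = (\<Sum>y\<in>F. \<Sum>x\<in>F. of_real (w y) * k y * (of_real (w x) * cnj (k x)) *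
      (cnj (V y \<omega>) * V x \<omega>))" for \<omega>
    unfolding h_def cnj_sum sum_product by (intro sum.cong refl) (simp add: mult_ac)
  have int_hh: "integrable M (\<lambda>\<omega>. cnj (h \<omega>) * h \<omega>)"
    unfolding hh using VV by (intro Bochner_Integration.integrable_sum integrable_mult_right) auto
  have hh_sq: "cnj (h \<omega>) * h \<omega> = of_real ((cmod (h \<omega>))\<^sup>2)" for \<omega>
    by (simp add: complex_norm_square mult.commute del: of_real_power)
  have int_h2: "integrable M (\<lambda>\<omega>. (cmod (h \<omega>))\<^sup>2)"
    using integrable_Re[OF int_hh] unfolding hh_sq by simp
  define Q where "Q = integral\<^sup>L M (\<lambda>\<omega>. (cmod (h \<omega>))\<^sup>2)"
  have "of_real Q = integral\<^sup>L M (\<lambda>\<omega>. cnj (h \<omega>) * h \<omega>)"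
    unfolding hh_sq Q_def by (simp del: of_real_power)
  also have "\<dots> = (\<Sum>y\<in>F. \<Sum>x\<in>F. of_real (w y) * k y * (of_real (w x) * cnj (k x)) * P y x)"
    unfolding hh using VV
    by (subst Bochner_Integration.integral_sum, fastforce)
      (auto simp: P_def intro!: sum.cong)
  finally have Q_eq: "complex_of_real Q =
     (\<Sum>y\<in>F. \<Sum>x\<in>F. of_real (w y) * k y * (of_real (w x) * cnj (k x)) * P y x)" .
  have "Q \<le> cmod (of_real Q)" by simp
  also have "\<dots> \<le> (\<Sum>y\<in>F. \<Sum>x\<in>F. w y * cmod (k y) * (w x * cmod (k x)) * cmod (P y x))"
    unfolding Q_eq using w
    by (intro order_trans[OF norm_sum] sum_mono) (simp add: norm_mult)
  \<comment> \<open>The product of \<open>cmod (k y)\<close> and \<open>cmod (k x)\<close> is at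
    most half the sum of their squares. By \<open>P_commute\<close> the two halves are mirror
    images, so they coincide once the sums are exchanged.\<close>
  also have "\<dots> \<le> (\<Sum>y\<in>F. \<Sum>x\<in>F. (w y * (cmod (k y))\<^sup>2 * (w x * cmod (P y x))
       + w x * (cmod (k x))\<^sup>2 * (w y * cmod (P x y))) / 2)"
  proof (intro sum_mono)
    fix x y
    have "(2 * cmod (k y) * cmod (k x)) * (w y * w x * cmod (P y x))
       \<le> ((cmod (k y))\<^sup>2 + (cmod (k x))\<^sup>2) * (w y * w x * cmod (P y x))"
      using w sum_squares_bound by (intro mult_right_mono) auto
    then show "w y * cmod (k y) * (w x * cmod (k x)) * cmod (P y x)
      \<le> (w y * (cmod (k y))\<^sup>2 * (w x * cmod (P y x)) + w x * (cmod (k x))\<^sup>2 * (w y * cmod (P x y))) / 2"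
      by (simp add: P_commute[of x y] algebra_simps)
  qed
  also have "\<dots> = (\<Sum>x\<in>F. w x * (cmod (k x))\<^sup>2 * (\<Sum>y\<in>F. w y * cmod (P x y)))"
  proof -
    have "(\<Sum>y\<in>F. \<Sum>x\<in>F. w x * (cmod (k x))\<^sup>2 * (w y * cmod (P x y)))
      = (\<Sum>x\<in>F. \<Sum>y\<in>F. w x * (cmod (k x))\<^sup>2 * (w y * cmod (P x y)))"
      by (rule sum.swap)
    moreover have "(\<Sum>x\<in>F. \<Sum>y\<in>F. w x * (cmod (k x))\<^sup>2 * (w y * cmod (P x y)))
      = (\<Sum>x\<in>F. w x * (cmod (k x))\<^sup>2 * (\<Sum>y\<in>F. w y * cmod (P x y)))"
      by (simp only: sum_distrib_left)
    ultimately show ?thesis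
      unfolding sum_divide_distrib[symmetric] sum.distrib by simp
  qed
  also have "\<dots> \<le> (\<Sum>x\<in>F. w x * (cmod (k x))\<^sup>2 * C)"
    using C w by (intro sum_mono mult_left_mono) (auto simp: P_def)
  finally have Q_le: "Q \<le> S * C" by (simp add: S_def sum_distrib_right)
  \<comment> \<open>\<open>2 |X0| |h| \<le> t |X0|\<^sup>2 + |h|\<^sup>2 / t\<close> replaces Cauchy-Schwarz\<close>
  have "2 * S \<le> t * A + S * C / t" if t: "0 < t" for t
  proof -
    have "S = cmod (integral\<^sup>L M (\<lambda>\<omega>. X0 \<omega> * h \<omega>))" using S0 by (simp add: S_eq)
    also have "\<dots> \<le> integral\<^sup>L M (\<lambda>\<omega>. cmod (X0 \<omega> * h \<omega>))" by (rule integral_norm_bound)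
    also have "\<dots> \<le> integral\<^sup>L M (\<lambda>\<omega>. t / 2 * (cmod (X0 \<omega>))\<^sup>2 + 1 / (2 * t) * (cmod (h \<omega>))\<^sup>2)"
    proof (intro integral_mono)
      show "integrable M (\<lambda>\<omega>. cmod (X0 \<omega> * h \<omega>))" using int_Xh by (rule integrable_norm)
      show "integrable M (\<lambda>\<omega>. t / 2 * (cmod (X0 \<omega>))\<^sup>2 + 1 / (2 * t) * (cmod (h \<omega>))\<^sup>2)"
        using X0 int_h2 by (intro Bochner_Integration.integrable_add integrable_mult_right)
      fix \<omega>
      have "0 \<le> (t * cmod (X0 \<omega>) - cmod (h \<omega>))\<^sup>2" by simp
      then have "2 * t * (cmod (X0 \<omega>) * cmod (h \<omega>)) \<le> t\<^sup>2 * (cmod (X0 \<omega>))\<^sup>2 + (cmod (h \<omega>))\<^sup>2"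
        by (simp add: power2_eq_square algebra_simps)
      then show "cmod (X0 \<omega> * h \<omega>) \<le> t / 2 * (cmod (X0 \<omega>))\<^sup>2 + 1 / (2 * t) * (cmod (h \<omega>))\<^sup>2"
        using t by (simp add: norm_mult field_simps power2_eq_square)
    qed
    also have "\<dots> = t / 2 * A + 1 / (2 * t) * Q"
      using X0 int_h2 by (simp add: A_def Q_def)
    also have "\<dots> \<le> t / 2 * A + 1 / (2 * t) * (S * C)"
      using Q_le t by (intro add_left_mono mult_left_mono) auto
    finally show ?thesis by (simp add: field_simps)
  qed
  then have "S \<le> C * A" by (rule le_mult_of_scaled_mean_le[OF A0 C(1)])
  then show ?thesis by (simp add: S_def A_def k_def)
qed

section \<open>Centering, the constant \<open>M_const\<close> and the passage to infinite
  sums\<close>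

lemma (in prob_space) integrable_of_square_integrable:
  fixes X :: "'a \<Rightarrow> complex"
  assumes "X \<in> borel_measurable M" "integrable M (\<lambda>\<omega>. (cmod (X \<omega>))\<^sup>2)"
  shows "integrable M X"
proof (rule Bochner_Integration.integrable_bound)
  show "integrable M (\<lambda>\<omega>. (cmod (X \<omega>))\<^sup>2 + 1)" using assms by simp
  have "cmod (X \<omega>) \<le> (cmod (X \<omega>))\<^sup>2 + 1" for \<omega>
  proof -
    have "2 * cmod (X \<omega>) \<le> (cmod (X \<omega>))\<^sup>2 + 1"
      using sum_squares_bound[of "cmod (X \<omega>)" 1] by simp
    then show ?thesis using norm_ge_zero[of "X \<omega>"] by linarith
  qed
  then show "AE \<omega> in M. norm (X \<omega>) \<le> norm ((cmod (X \<omega>))\<^sup>2 + 1)" by simp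
qed (use assms in simp)

lemma (in prob_space) covX_centered:
  fixes X :: "'a \<Rightarrow> complex"
  assumes X: "X \<in> borel_measurable M" "integrable M (\<lambda>\<omega>. (cmod (X \<omega>))\<^sup>2)"
  defines "c \<equiv> integral\<^sup>L M X"
  shows "integrable M (\<lambda>\<omega>. (cmod (X \<omega> - c))\<^sup>2)"
    and "integral\<^sup>L M (\<lambda>\<omega>. (cmod (X \<omega> - c))\<^sup>2) = covX M X"
proof -
  have int: "integrable M X" using X by (rule integrable_of_square_integrable)
  define r where "r \<omega> = Re (cnj c * X \<omega>)" for \<omega>
  have eq: "(cmod (X \<omega> - c))\<^sup>2 = (cmod (X \<omega>))\<^sup>2 - 2 * r \<omega> + (cmod c)\<^sup>2" for \<omega>
    unfolding cmod_power2 r_def by (simp add: power2_eq_square algebra_simps)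
  have r: "integrable M r" unfolding r_def using int by (intro integrable_Re) simp
  show "integrable M (\<lambda>\<omega>. (cmod (X \<omega> - c))\<^sup>2)" unfolding eq using X r by simp
  have "integral\<^sup>L M r = Re (integral\<^sup>L M (\<lambda>\<omega>. cnj c * X \<omega>))"
    unfolding r_def using int by (intro integral_Re) simp
  also have "\<dots> = Re (cnj c * c)" unfolding c_def using int by simp
  also have "\<dots> = (cmod c)\<^sup>2" unfolding cmod_power2 by (simp add: power2_eq_square)
  finally show "integral\<^sup>L M (\<lambda>\<omega>. (cmod (X \<omega> - c))\<^sup>2) = covX M X"
    unfolding eq using X r by (simp add: covX_def c_def prob_space)
qed

lemma M_const_nonneg: "1 \<le> n \<Longrightarrow> 0 \<le> M_const M \<phi> p n"
  unfolding M_const_def by (rule order_trans[OF _ Max_ge[OF _ imageI[of 1]]]) auto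

text \<open>Peeled blocks have at least two elements. In that range the norm is a
  \<open>powr\<close>, hence nonnegative, so the power \<open>k\<close> undoes the root taken in
  \<open>M_const\<close>.\<close>

lemma clust_norm_le_M_const:
  assumes k: "2 \<le> k" "k \<le> n"
  shows "clust_norm M \<phi> p k \<le> fact k * M_const M \<phi> p n ^ k"
proof -
  let ?c = "clust_norm M \<phi> p k / fact k"
  have c: "0 \<le> clust_norm M \<phi> p k" using k by (simp add: clust_norm_def)
  have "?c powr (1 / k) \<le> M_const M \<phi> p n"
    unfolding M_const_def using k by (intro Max_ge) auto
  then have "(?c powr (1 / k)) ^ k \<le> M_const M \<phi> p n ^ k"
    by (intro power_mono) auto
  moreover have "(?c powr (1 / k)) ^ k = ?c"
    using k c by (cases "?c = 0") (simp_all add: powr_realpow[symmetric] powr_powr)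
  ultimately have "?c \<le> M_const M \<phi> p n ^ k" by simp
  then show ?thesis by (simp add: field_simps)
qed

lemma nonneg_infsum_bounded:
  fixes f :: "'x \<Rightarrow> real"
  assumes "\<And>x. x \<in> A \<Longrightarrow> 0 \<le> f x"
    and "\<And>F. finite F \<Longrightarrow> F \<subseteq> A \<Longrightarrow> sum f F \<le> B"
  shows "f summable_on A" "infsum f A \<le> B"
proof -
  show s: "f summable_on A"
    using assms by (intro nonneg_bdd_above_summable_on) (auto simp: bdd_above_def)
  show "infsum f A \<le> B" using assms(2) by (intro infsum_le_finite_sums[OF s])
qed

lemma (in prob_space) weighted_cumulant_sum_le:
  fixes \<phi> :: "'z \<Rightarrow> 'a \<Rightarrow> complex"
  assumes rf: "random_field M \<phi>" and s: "\<And>y. AE \<omega> in M. cnj (\<phi> y \<omega>) = \<phi> (s y) \<omega>"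
    and mom: "moments_exist M \<phi> (2 * n)" and n: "1 \<le> n"
    and X: "X \<in> borel_measurable M" "integrable M (\<lambda>\<omega>. (cmod (X \<omega>))\<^sup>2)"
    and w: "\<And>x. 0 \<le> w x" and C: "0 \<le> C"
    and F: "finite F" "F \<subseteq> {x. length x = n}"
    and PC: "\<And>x. x \<in> F \<Longrightarrow> (\<Sum>y\<in>F. w y * cmod (Phi M \<phi> x y)) \<le> C"
  shows "(\<Sum>x\<in>F. w x * (cmod (cumulant M (X # map \<phi> x)))\<^sup>2) \<le> C * covX M X"
proof -
  define c where "c = integral\<^sup>L M X"
  define V where "V x = wick M (map \<phi> x)" for x
  have XV: "integrable M (\<lambda>\<omega>. (X \<omega> - c) * V x \<omega>)"
    "integral\<^sup>L M (\<lambda>\<omega>. (X \<omega> - c) * V x \<omega>) = cumulant M (X # map \<phi> x)" if x: "x \<in> F" for x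
  proof -
    have len: "length x = n" using x F by auto
    have int: "integrable M (\<lambda>\<omega>. \<Prod>i\<in>E. \<phi> (x ! i) \<omega>)" if "E \<subseteq> {..<length x}" for E
      using card_mono[OF _ that] finite_subset[OF that] len
      by (intro moments_exist_prod[OF mom]) auto
    have V: "integrable M (V x)"
      using integrable_mult_wick_idx[of "{..<length x}" M "\<lambda>_. 1" "\<lambda>i. \<phi> (x ! i)"] int
      by (simp add: V_def wick_map[abs_def])
    \<comment> \<open>Here \<open>1 \<le> n\<close> enters: the Wick polynomial of the empty list is
      1. Mean zero is what permits \<open>X\<close> to be centered without changing the
      cumulants.\<close>
    have V0: "integral\<^sup>L M (V x) = 0"
      unfolding V_def wick_map[abs_def] using n len int
      by (intro integral_wick_idx_eq_0) (auto simp: lessThan_empty_iff)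
    have *: "cumulant M (X # map \<phi> x) = integral\<^sup>L M (\<lambda>\<omega>. X \<omega> * V x \<omega>)"
      "integrable M (\<lambda>\<omega>. X \<omega> * V x \<omega>)"
      unfolding V_def using len by (intro cumulant_eq_integral_wick[OF rf s mom _ X]; simp)+
    show "integrable M (\<lambda>\<omega>. (X \<omega> - c) * V x \<omega>)"
      "integral\<^sup>L M (\<lambda>\<omega>. (X \<omega> - c) * V x \<omega>) = cumulant M (X # map \<phi> x)"
      using * V V0 by (simp_all add: left_diff_distrib)
  qed
  have "(\<Sum>x\<in>F. w x * (cmod (integral\<^sup>L M (\<lambda>\<omega>. (X \<omega> - c) * V x \<omega>)))\<^sup>2)
      \<le> C * integral\<^sup>L M (\<lambda>\<omega>. (cmod (X \<omega> - c))\<^sup>2)"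
  proof (rule weighted_bessel[OF F(1) w _ XV(1) _ C])
    show "integrable M (\<lambda>\<omega>. (cmod (X \<omega> - c))\<^sup>2)"
      unfolding c_def by (rule covX_centered(1)[OF X])
    show "integrable M (\<lambda>\<omega>. cnj (V y \<omega>) * V x \<omega>)" if "x \<in> F" "y \<in> F" for x y
      unfolding V_def using that F by (intro integrable_wick_pair_map[OF rf s mom, of _ n]) auto
    show "(\<Sum>y\<in>F. w y * cmod (integral\<^sup>L M (\<lambda>\<omega>. cnj (V x \<omega>) * V y \<omega>))) \<le> C" if "x \<in> F" for x
      using PC[OF that] by (simp add: Phi_eq V_def)
  qed
  then show ?thesis
    using XV(2) unfolding c_def covX_centered(2)[OF X] by simp
qed

theorem mainTheorem1:
  fixes M :: "'w measure" and \<phi> :: "'z::countable \<Rightarrow> 'w \<Rightarrow> complex"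
    and X :: "'w \<Rightarrow> complex" and p :: real and N :: nat
  assumes "prob_space M"
    and "random_field M \<phi>" and "closed_conj M \<phi>"
    and "1 \<le> N"
    and "1 \<le> p"
    and "clustering M \<phi> p (2 * N)"
    and "X \<in> borel_measurable M" and "integrable M (\<lambda>\<omega>. (cmod (X \<omega>))\<^sup>2)"
  shows "\<forall>n. 1 \<le> n \<and> n \<le> N \<longrightarrow>
     (p = 1 \<longrightarrow>
        (\<lambda>x. (cmod (cumulant M (X # map \<phi> x)))\<^sup>2) summable_on {x. length x = n} \<and>
        sqrt (\<Sum>\<^sub>\<infinity>x\<in>{x. length x = n}. (cmod (cumulant M (X # map \<phi> x)))\<^sup>2)
          \<le> sqrt (covX M X) * M_const M \<phi> 1 (2 * n) ^ n * exp (real n) * sqrt (fact (2 * n)))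
   \<and> (p = 2 \<longrightarrow>
        (\<forall>x'. length x' = n \<longrightarrow>
          (\<lambda>x. cmod (Phi M \<phi> x' x) * (cmod (cumulant M (X # map \<phi> x)))\<^sup>2) summable_on {x. length x = n} \<and>
          sqrt (\<Sum>\<^sub>\<infinity>x\<in>{x. length x = n}. cmod (Phi M \<phi> x' x) * (cmod (cumulant M (X # map \<phi> x)))\<^sup>2)
            \<le> sqrt (covX M X) * M_const M \<phi> 2 (2 * n) ^ (2 * n) * exp (real (2 * n)) * fact (2 * n)))"
proof -
  interpret prob_space M by fact
  note rf = assms(2) and X = assms(7,8)
  obtain s where s: "\<And>y. AE \<omega> in M. cnj (\<phi> y \<omega>) = \<phi> (s y) \<omega>"
    using assms(3) unfolding closed_conj_def by metis
  have main: "(\<Sum>x\<in>F. w x * (cmod (cumulant M (X # map \<phi> x)))\<^sup>2) \<le> C * covX M X"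
    if "1 \<le> n" "n \<le> N" "\<And>x. 0 \<le> w x" "0 \<le> C" "finite F" "F \<subseteq> {x. length x = n}"
      "\<And>x. x \<in> F \<Longrightarrow> (\<Sum>y\<in>F. w y * cmod (Phi M \<phi> x y)) \<le> C" for n w C F
  proof -
    have "moments_exist M \<phi> (2 * n)"
      using assms(6) that(2) unfolding clustering_def moments_exist_def
      by (meson mult_le_mono2 order_trans)
    then show ?thesis using that by (intro weighted_cumulant_sum_le[OF rf s _ _ X]) auto
  qed
  \<comment> \<open>One constant serves both items: for \<open>p = 1\<close> it is the Schur
    constant, for \<open>p = 2\<close> the Schur constant is its square.\<close>
  define D where "D n = M_const M \<phi> p (2 * n) ^ (2 * n) * exp (real (2 * n)) * fact (2 * n)" for n
  have D0: "0 \<le> D n" if "1 \<le> n" for n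
    using that M_const_nonneg[of "2 * n" M \<phi> p] by (simp add: D_def)
  have Phi: "lp_norm p F (Phi M \<phi> x') \<le> D n"
    if n: "1 \<le> n" "n \<le> N" and p: "p = 1 \<or> p = 2" and F: "finite F" "F \<subseteq> {x. length x = n}"
      and x': "length x' = n" for n F x'
  proof -
    let ?\<mu> = "M_const M \<phi> p (2 * n)"
    have \<mu>: "0 \<le> ?\<mu>" using n by (intro M_const_nonneg) simp
    have "lp_norm p F (Phi M \<phi> x') \<le> fact (2 * n) * (2 * ?\<mu>) ^ (2 * n)"
      using n by (intro lp_norm_Phi_le[OF rf s p assms(6) _ \<mu> _ F x'] clust_norm_le_M_const) auto
    also have "\<dots> = ?\<mu> ^ (2 * n) * 2 ^ (2 * n) * fact (2 * n)"
      by (simp only: power_mult_distrib mult_ac)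
    \<comment> \<open>The base 2 of the block count is replaced by \<open>exp 1\<close>, using
      \<open>1 + 1 \<le> exp 1\<close>.\<close>
    also have "\<dots> \<le> ?\<mu> ^ (2 * n) * exp 1 ^ (2 * n) * fact (2 * n)"
      using \<mu> exp_ge_add_one_self[of 1] by (intro mult_right_mono mult_left_mono power_mono) auto
    also have "exp (1::real) ^ (2 * n) = exp (real (2 * n))"
      by (simp add: exp_of_nat_mult[symmetric])
    finally show ?thesis by (simp add: D_def)
  qed
  show ?thesis
  proof (intro allI impI conjI; elim conjE)
    fix n assume n: "1 \<le> n" "n \<le> N" and p: "p = 1"
    let ?f = "\<lambda>x. (cmod (cumulant M (X # map \<phi> x)))\<^sup>2"
    have "sum ?f F \<le> D n * covX M X" if F: "finite F" "F \<subseteq> {x. length x = n}" for F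
      using main[OF n, of "\<lambda>_. 1" "D n" F] Phi[OF n _ F] F D0[OF n(1)] by (auto simp: p lp_norm_1)
    note bd = nonneg_infsum_bounded[OF _ this]
    show "?f summable_on {x. length x = n}" by (rule bd) simp_all
    have "infsum ?f {x. length x = n} \<le> D n * covX M X" by (rule bd) simp_all
    then have "sqrt (infsum ?f {x. length x = n}) \<le> sqrt (D n * covX M X)" by simp
    also have "\<dots> = sqrt (covX M X) * M_const M \<phi> 1 (2 * n) ^ n * exp (real n) * sqrt (fact (2 * n))"
    proof -
      have "0 \<le> M_const M \<phi> 1 (2 * n)" using n by (intro M_const_nonneg) simp
      then have "sqrt (M_const M \<phi> 1 (2 * n) ^ (2 * n)) = M_const M \<phi> 1 (2 * n) ^ n"
        by (simp add: power_even_eq real_sqrt_abs)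
      moreover have "sqrt (exp (real (2 * n))) = exp (real n)"
        by (rule real_sqrt_unique) (simp_all add: exp_double[symmetric])
      ultimately show ?thesis by (simp only: D_def p real_sqrt_mult mult_ac)
    qed
    finally show "sqrt (infsum ?f {x. length x = n})
      \<le> sqrt (covX M X) * M_const M \<phi> 1 (2 * n) ^ n * exp (real n) * sqrt (fact (2 * n))" .
  next
    fix n and x' :: "'z list" assume n: "1 \<le> n" "n \<le> N" and p: "p = 2" and x': "length x' = n"
    let ?f = "\<lambda>x. cmod (Phi M \<phi> x' x) * (cmod (cumulant M (X # map \<phi> x)))\<^sup>2"
    have "sum ?f F \<le> (D n)\<^sup>2 * covX M X" if F: "finite F" "F \<subseteq> {x. length x = n}" for F
    proof (rule main[OF n _ _ F])
      fix x assume "x \<in> F"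
      then have x: "length x = n" using F by auto
      \<comment> \<open>The weight and the kernel are two rows of \<open>Phi\<close>, each of norm
        at most \<open>D n\<close>. Cauchy-Schwarz gives the Schur constant
        \<open>D n * D n\<close>, and the square root taken at the end returns
        \<open>D n\<close>.\<close>
      have "(\<Sum>y\<in>F. cmod (Phi M \<phi> x' y) * cmod (Phi M \<phi> x y))
          \<le> lp_norm 2 F (Phi M \<phi> x') * lp_norm 2 F (Phi M \<phi> x)"
        using L2_set_mult_ineq[of "\<lambda>y. cmod (Phi M \<phi> x' y)" "\<lambda>y. cmod (Phi M \<phi> x y)" F]
        by (simp add: lp_norm_2)
      also have "\<dots> \<le> D n * D n"
        using Phi[OF n _ F x'] Phi[OF n _ F x] D0[OF n(1)] by (intro mult_mono) (auto simp: p)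
      finally show "(\<Sum>y\<in>F. cmod (Phi M \<phi> x' y) * cmod (Phi M \<phi> x y)) \<le> (D n)\<^sup>2"
        by (simp add: power2_eq_square)
    qed auto
    note bd = nonneg_infsum_bounded[OF _ this]
    show "?f summable_on {x. length x = n}" by (rule bd) simp_all
    have "infsum ?f {x. length x = n} \<le> (D n)\<^sup>2 * covX M X" by (rule bd) simp_all
    then have "sqrt (infsum ?f {x. length x = n}) \<le> sqrt ((D n)\<^sup>2 * covX M X)" by simp
    also have "\<dots> = sqrt (covX M X) * D n" using D0[OF n(1)] by (simp add: real_sqrt_mult)
    finally show "sqrt (infsum ?f {x. length x = n})
      \<le> sqrt (covX M X) * M_const M \<phi> 2 (2 * n) ^ (2 * n) * exp (real (2 * n)) * fact (2 * n)"
      by (simp only: D_def p mult.assoc)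
  qed
qed

end
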